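(* Let $n\in\mathbb N$ and let $\alpha(t,x),\gamma(t,x)$ be positive $C^\infty$-smooth functions in a neighborhood of the point $q_*=(0,x_* )$ of the $(t,x)$-plane. Let $M=\sum_{i=0}^3\mu_i(t,x)p^i$ with $$\mu_3=\alpha(t\alpha_t-2n\alpha),\quad \mu_2=t(\alpha_x\gamma-2\alpha\gamma_x),\quad \mu_1=t(2\alpha_t\gamma-\alpha\gamma_t)-2n\alpha\gamma,\quad \mu_0=-t\gamma\gamma_x ,$$ and let $\vec V$ be the vector field in $(t,x,p)$-space $$\dot t=t,\quad\dot x=pt,\quad\dot p=-\frac{M}{2\alpha\gamma}.$$ Then the germ of $\vec V$ at the singular point $(q_*,0)$, i.e. $(t,x,p)=(0,x_*,0)$, is smoothly orbitally equivalent to $$\dot\xi=n\xi+\varphi(\zeta)\eta^n,\quad\dot\eta=\eta,\quad\dot\zeta=0$$ for some smooth function $\varphi(\zeta)$.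
   Context: "Smooth" means $C^\infty$. Subscripts $t,x$ denote partial derivatives. The field $\vec V$ is proportional (off $\{t=0\}$) to the field generated by the Euler–Lagrange equation of geodesics of the Klein-type metric $ds^2=(\alpha\,dx^2+\gamma\,dt^2)/t^{2n}$, with $p=dx/dt$. Two germs of vector fields are smoothly orbitally equivalent if a germ of a $C^\infty$-diffeomorphism takes one of them to the other multiplied by a non-vanishing $C^\infty$ function; here the germ of $\vec V$ at the singular point is compared with the germ of the normal form at the origin of $(\xi,\eta,\zeta)$-space. *)

theory Defs
  imports "HOL-Analysis.Analysis"
begin

(* Meant for open S only: derivatives are taken with respect to the full filter at x.
   C^k is expressed through the directional derivatives of the Frechet derivative, and
   continuity at order 0 makes it continuity of all derivatives up to order k. *)
primrec Ck_on :: "nat \<Rightarrow> 'a::real_normed_vector set \<Rightarrow> ('a \<Rightarrow> 'b::real_normed_vector) \<Rightarrow> bool"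
  where
    "Ck_on 0 S f \<longleftrightarrow> continuous_on S f"
  | "Ck_on (Suc k) S f \<longleftrightarrow>
       (\<forall>x\<in>S. f differentiable (at x)) \<and>
       (\<forall>v. Ck_on k S (\<lambda>x. frechet_derivative f (at x) v))"

definition smooth_on :: "'a::real_normed_vector set \<Rightarrow> ('a \<Rightarrow> 'b::real_normed_vector) \<Rightarrow> bool"
  where "smooth_on S f \<longleftrightarrow> (\<forall>k. Ck_on k S f)"

definition diffeomorphism ::
    "'a::real_normed_vector set \<Rightarrow> 'b::real_normed_vector set \<Rightarrow> ('a \<Rightarrow> 'b) \<Rightarrow> bool"
  where "diffeomorphism U W F \<longleftrightarrow>
    open U \<and> open W \<and>
    (\<exists>G. homeomorphism U W F G \<and> smooth_on U F \<and> smooth_on W G)"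

(* The germ of X at a is compared with the germ of Y at b: on a neighbourhood of a the
   push-forward of X along F is Y multiplied by a non-vanishing function. The multiplier h is
   written in the source coordinates, i.e. it is the pull-back along F of the factor of Y. *)
definition smoothly_orbitally_equivalent ::
    "('a::real_normed_vector \<Rightarrow> 'a) \<Rightarrow> 'a \<Rightarrow> ('b::real_normed_vector \<Rightarrow> 'b) \<Rightarrow> 'b \<Rightarrow> bool"
  where "smoothly_orbitally_equivalent X a Y b \<longleftrightarrow>
    (\<exists>U W F (h :: 'a \<Rightarrow> real).
       diffeomorphism U W F \<and> a \<in> U \<and> F a = b \<and>
       smooth_on U h \<and> (\<forall>q\<in>U. h q \<noteq> 0) \<and>
       (\<forall>q\<in>U. frechet_derivative F (at q) (X q) = h q *\<^sub>R Y (F q)))"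

definition partial_t :: "(real \<times> real \<Rightarrow> real) \<Rightarrow> real \<times> real \<Rightarrow> real"
  where "partial_t f = (\<lambda>(t, x). deriv (\<lambda>s. f (s, x)) t)"

definition partial_x :: "(real \<times> real \<Rightarrow> real) \<Rightarrow> real \<times> real \<Rightarrow> real"
  where "partial_x f = (\<lambda>(t, x). deriv (\<lambda>y. f (t, y)) x)"

context
  fixes n :: nat and \<alpha> \<gamma> :: "real \<times> real \<Rightarrow> real"
begin

definition mu3 :: "real \<times> real \<Rightarrow> real"
  where "mu3 = (\<lambda>(t, x). \<alpha> (t, x) * (t * partial_t \<alpha> (t, x) - 2 * real n * \<alpha> (t, x)))"

definition mu2 :: "real \<times> real \<Rightarrow> real"
  where "mu2 = (\<lambda>(t, x).
    t * (partial_x \<alpha> (t, x) * \<gamma> (t, x) - 2 * \<alpha> (t, x) * partial_x \<gamma> (t, x)))"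

definition mu1 :: "real \<times> real \<Rightarrow> real"
  where "mu1 = (\<lambda>(t, x).
    t * (2 * partial_t \<alpha> (t, x) * \<gamma> (t, x) - \<alpha> (t, x) * partial_t \<gamma> (t, x))
      - 2 * real n * \<alpha> (t, x) * \<gamma> (t, x))"

definition mu0 :: "real \<times> real \<Rightarrow> real"
  where "mu0 = (\<lambda>(t, x). - (t * \<gamma> (t, x) * partial_x \<gamma> (t, x)))"

definition geodesic_M :: "real \<times> real \<times> real \<Rightarrow> real"
  where "geodesic_M = (\<lambda>(t, x, p).
    mu0 (t, x) + mu1 (t, x) * p + mu2 (t, x) * p ^ 2 + mu3 (t, x) * p ^ 3)"

definition geodesic_field :: "real \<times> real \<times> real \<Rightarrow> real \<times> real \<times> real"
  where "geodesic_field = (\<lambda>(t, x, p).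
    (t, p * t, - (geodesic_M (t, x, p) / (2 * \<alpha> (t, x) * \<gamma> (t, x)))))"

end

definition normal_form :: "nat \<Rightarrow> (real \<Rightarrow> real) \<Rightarrow> real \<times> real \<times> real \<Rightarrow> real \<times> real \<times> real"
  where "normal_form n \<phi> = (\<lambda>(\<xi>, \<eta>, \<zeta>). (real n * \<xi> + \<phi> \<zeta> * \<eta> ^ n, \<eta>, 0))"

end

theory Submission
  imports Defs
begin

text \<open>The function \<open>P = p / sqrt (1 + (\<alpha> / \<gamma>) p\<^sup>2)\<close> linearises \<open>V\<close> on \<open>{t = 0}\<close>: in the coordinates
  \<open>(t, x, P)\<close> the field becomes \<open>(t, t f, n P + t g)\<close> with smooth \<open>f\<close> and \<open>g\<close>. Its backward flow
  \<open>w q\<close> from \<open>q\<close> exists for all times \<open>s \<ge> 0\<close>, since it solves the integral equation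
  \<open>w = A q - t K (N \<circ> w)\<close>, where \<open>N = (0, f, g)\<close> and \<open>K\<close> is a bounded operator on the bounded continuous
  curves; this is a contraction for small \<open>t\<close>. Differentiating the fixed point gives linear
  fixed-point equations with the same contraction constant, so \<open>w\<close> is smooth in \<open>q\<close> on one
  neighbourhood, for all orders at once. For \<open>k > 0\<close> the function
  \<open>c q = \<integral>\<^sub>0\<^sup>\<infinity> exp (- k s) F (w q s) ds\<close> is then a smooth solution of \<open>V c + k c = F\<close>.

  With this equation the normal form follows by algebra. A solution for \<open>F = f\<close>, \<open>k = 1\<close> gives the
  first integral \<open>\<zeta> = x - t c\<close>. Starting from \<open>u = P\<close>, a remainder \<open>t\<^sup>k R\<close> in \<open>V u = n u + t\<^sup>k R\<close> is split by
  Hadamard's lemma as \<open>R = R (0, \<zeta>, 0) + t R\<^sub>2 + P R\<^sub>1\<close>; the last term is removed by \<open>P c\<close> with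
  \<open>V c + k c = R\<^sub>1\<close>, and the first one by a multiple of itself unless \<open>k = n\<close>, where it is the resonant term
  \<open>\<phi>(\<zeta>) t\<^sup>n\<close>. A remainder of order \<open>n + 1\<close> is removed completely by a solution with \<open>k = 1\<close>.\<close>

subsection \<open>Calculus of smooth functions\<close>

text \<open>The linear part of \<open>V\<close> at the singular point has eigenvalues 1, 0 and
  \<open>n\<close>, and the singular points fill the curve t = P = 0. So the situation is not
  hyperbolic, and the resonance of \<open>n\<close> with the \<open>n\<close>-th power of t
  persists. All nonzero eigenvalues are positive, however, hence t decays like exp (- s) along
  backward orbits. This is the purpose of making every nonlinear term carry the factor t: besides
  the small constant it supplies the integrable weight exp (- s), so that even x, whose eigenvalue
  is 0, moves by a bounded amount over infinite time. On {t = 0} the field reads p' = n p (1 +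
  (\<alpha> / \<gamma>) p^2), a Bernoulli equation, whose linearisation is the formula for P.
  Smoothness of integrals depending on parameters is always obtained in one way: the parameter
  enters through a smooth map into a Banach space of bounded curves, and the integral is a bounded
  linear functional there.\<close>

lemma Ck_on_continuous: "Ck_on k S f \<Longrightarrow> continuous_on S f"
proof (cases k)
  case (Suc n)
  assume "Ck_on k S f"
  then show ?thesis
    using Suc by (auto intro!: continuous_at_imp_continuous_on differentiable_imp_continuous_within)
qed simp

lemma Ck_on_SucD: "Ck_on (Suc k) S f \<Longrightarrow> Ck_on k S f"
proof (induction k arbitrary: f)
  case 0
  then show ?case using Ck_on_continuous[of "Suc 0"] by simp
qed auto

lemma Ck_on_subset: "Ck_on k S f \<Longrightarrow> T \<subseteq> S \<Longrightarrow> Ck_on k T f"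
proof (induction k arbitrary: f)
  case 0
  then show ?case by (auto intro: continuous_on_subset)
next
  case (Suc k)
  then show ?case by auto
qed

lemma frechet_derivative_cong_open:
  assumes "open S" "\<And>x. x \<in> S \<Longrightarrow> f x = g x" "x \<in> S"
  shows "frechet_derivative f (at x) = frechet_derivative g (at x)"
proof -
  have "(f has_derivative D) (at x) \<longleftrightarrow> (g has_derivative D) (at x)" for D
    using has_derivative_transform_within_open[of f D x UNIV S g]
      has_derivative_transform_within_open[of g D x UNIV S f] assms by auto
  then show ?thesis
    by (simp add: frechet_derivative_def)
qed

lemma Ck_on_Suc_has_derivative:
  assumes "Ck_on (Suc k) S f" "x \<in> S"
  shows "(f has_derivative frechet_derivative f (at x)) (at x)"
  using assms frechet_derivative_works by auto

lemma Ck_on_cong_imp: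
  assumes "open S" "\<And>x. x \<in> S \<Longrightarrow> f x = g x" "Ck_on k S f"
  shows "Ck_on k S g"
  using assms(2,3)
proof (induction k arbitrary: f g)
  case 0
  then show ?case by (auto cong: continuous_on_cong)
next
  case (Suc k)
  have "g differentiable (at x)" if "x \<in> S" for x
    using Ck_on_Suc_has_derivative[OF Suc.prems(2) that]
      has_derivative_transform_within_open[of f _ x UNIV S g] that assms(1) Suc.prems(1)
    by (auto simp: differentiable_def)
  moreover have "Ck_on k S (\<lambda>x. frechet_derivative g (at x) v)" for v
  proof (rule Suc.IH)
    show "Ck_on k S (\<lambda>x. frechet_derivative f (at x) v)"
      using Suc.prems by simp
    show "frechet_derivative f (at x) v = frechet_derivative g (at x) v" if "x \<in> S" for x
      using frechet_derivative_cong_open[OF assms(1) Suc.prems(1) that] by simp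
  qed
  ultimately show ?case by simp
qed

text \<open>Derivatives are unique and \<open>Ck_on\<close> respects pointwise equality on open
  sets, so any explicit family of derivatives may stand for \<open>frechet_derivative\<close>. The
  inductions on the order below work through this rule.\<close>

lemma Ck_on_SucI:
  assumes "open S" "\<And>x. x \<in> S \<Longrightarrow> (f has_derivative f' x) (at x)"
    and "\<And>v. Ck_on k S (\<lambda>x. f' x v)"
  shows "Ck_on (Suc k) S f"
proof -
  have "frechet_derivative f (at x) = f' x" if "x \<in> S" for x
    using assms(2)[OF that] by (metis frechet_derivative_at)
  then have "Ck_on k S (\<lambda>x. frechet_derivative f (at x) v)" for v
    using Ck_on_cong_imp[OF assms(1) _ assms(3)] by simp
  then show ?thesis
    using assms(2) by (auto simp: differentiable_def)
qed

lemma Ck_on_const [simp]: "open S \<Longrightarrow> Ck_on k S (\<lambda>x. c)"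
proof (induction k arbitrary: c)
  case (Suc k)
  show ?case by (rule Ck_on_SucI[where f'="\<lambda>_ _. 0"]) (use Suc in auto)
qed simp

lemma Ck_on_ident: "open S \<Longrightarrow> Ck_on k S (\<lambda>x. x)"
proof (cases k)
  case (Suc k')
  assume "open S"
  then show ?thesis unfolding Suc by (intro Ck_on_SucI[where f'="\<lambda>_ v. v"]) auto
qed simp

lemma Ck_on_bounded_linear_comp:
  assumes "bounded_linear h" "open S" "Ck_on k S f"
  shows "Ck_on k S (\<lambda>x. h (f x))"
  using assms(3)
proof (induction k arbitrary: f)
  case 0
  then show ?case
    using bounded_linear.continuous_on[OF assms(1)] by auto
next
  case (Suc k)
  show ?case
  proof (rule Ck_on_SucI[OF assms(2)])
    show "((\<lambda>x. h (f x)) has_derivative (\<lambda>v. h (frechet_derivative f (at x) v))) (at x)" if "x \<in> S" for x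
      using bounded_linear.has_derivative[OF assms(1) Ck_on_Suc_has_derivative[OF Suc.prems that]] .
  qed (use Suc in auto)
qed

lemma Ck_on_add:
  assumes "open S" "Ck_on k S f" "Ck_on k S g"
  shows "Ck_on k S (\<lambda>x. f x + g x)"
  using assms(2,3)
proof (induction k arbitrary: f g)
  case 0
  then show ?case by (auto intro: continuous_intros)
next
  case (Suc k)
  show ?case
    by (rule Ck_on_SucI[OF assms(1) has_derivative_add[OF Ck_on_Suc_has_derivative Ck_on_Suc_has_derivative]])
      (use Suc in auto)
qed

lemma Ck_on_bounded_bilinear:
  assumes "bounded_bilinear h" "open S" "Ck_on k S f" "Ck_on k S g"
  shows "Ck_on k S (\<lambda>x. h (f x) (g x))"
  using assms(3,4)
proof (induction k arbitrary: f g)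
  case 0
  then show ?case using bounded_bilinear.continuous_on[OF assms(1)] by auto
next
  case (Suc k)
  show ?case
  proof (rule Ck_on_SucI[OF assms(2) bounded_bilinear.FDERIV[OF assms(1) Ck_on_Suc_has_derivative Ck_on_Suc_has_derivative]])
    show "Ck_on k S (\<lambda>x. h (f x) (frechet_derivative g (at x) v) + h (frechet_derivative f (at x) v) (g x))" for v
      by (intro Ck_on_add assms Suc.IH) (use Suc.prems Ck_on_SucD in auto)
  qed (use Suc in auto)
qed

lemma Ck_on_sum:
  assumes "open S" "\<And>i. i \<in> I \<Longrightarrow> Ck_on k S (f i)"
  shows "Ck_on k S (\<lambda>x. \<Sum>i\<in>I. f i x)"
  using assms(2)
  by (induction I rule: infinite_finite_induct) (auto simp: assms(1) intro: Ck_on_add)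

lemma linear_euclidean_sum:
  fixes f :: "'a::euclidean_space \<Rightarrow> 'b::real_normed_vector"
  assumes "linear f"
  shows "f v = (\<Sum>b\<in>Basis. (v \<bullet> b) *\<^sub>R f b)"
  by (subst euclidean_representation[of v, symmetric])
    (simp add: linear_sum[OF assms] linear_scale[OF assms] del: euclidean_representation)

text \<open>The chain rule applies a moving linear map to a moving vector, while
  \<open>Ck_on\<close> speaks of fixed directions only. Expanding the vector in the basis separates
  the two factors, which is why the middle space is Euclidean.\<close>

lemma Ck_on_compose:
  fixes f :: "'a::real_normed_vector \<Rightarrow> 'b::euclidean_space"
    and g :: "'b \<Rightarrow> 'c::real_normed_vector"
  assumes "open S" "open T" "f ` S \<subseteq> T" "Ck_on k S f" "Ck_on k T g"
  shows "Ck_on k S (\<lambda>x. g (f x))"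
  using assms(4,5)
proof (induction k arbitrary: g)
  case 0
  then show ?case using assms(3) continuous_on_compose2[of T g S f] by auto
next
  case (Suc k)
  have dg: "(g has_derivative frechet_derivative g (at y)) (at y)" if "y \<in> T" for y
    using Ck_on_Suc_has_derivative[OF Suc.prems(2) that] .
  show ?case
  proof (rule Ck_on_SucI[OF assms(1)])
    fix x assume x: "x \<in> S"
    then have fx: "f x \<in> T" using assms(3) by auto
    have "((\<lambda>x. g (f x)) has_derivative (\<lambda>v. frechet_derivative g (at (f x)) (frechet_derivative f (at x) v))) (at x)"
      using has_derivative_compose[OF Ck_on_Suc_has_derivative[OF Suc.prems(1) x] dg[OF fx]] .
    then show "((\<lambda>x. g (f x)) has_derivative (\<lambda>v. \<Sum>b\<in>Basis. (frechet_derivative f (at x) v \<bullet> b) *\<^sub>R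
        frechet_derivative g (at (f x)) b)) (at x)"
      by (subst (asm) linear_euclidean_sum[OF has_derivative_linear[OF dg[OF fx]]])
  next
    fix v
    show "Ck_on k S (\<lambda>x. \<Sum>b\<in>Basis. (frechet_derivative f (at x) v \<bullet> b) *\<^sub>R frechet_derivative g (at (f x)) b)"
    proof (intro Ck_on_sum assms Ck_on_bounded_bilinear[OF bounded_bilinear_scaleR])
      fix b :: 'b
      show "Ck_on k S (\<lambda>x. frechet_derivative f (at x) v \<bullet> b)"
        by (intro Ck_on_bounded_linear_comp[OF bounded_linear_inner_left assms(1)]) (use Suc.prems in auto)
      show "Ck_on k S (\<lambda>x. frechet_derivative g (at (f x)) b)"
        by (rule Suc.IH) (use Suc.prems Ck_on_SucD in auto)
    qed
  qed
qed

lemma smooth_onD: "smooth_on S f \<Longrightarrow> Ck_on k S f"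
  by (simp add: smooth_on_def)

lemma smooth_on_has_derivative:
  "smooth_on S f \<Longrightarrow> x \<in> S \<Longrightarrow> (f has_derivative frechet_derivative f (at x)) (at x)"
  using Ck_on_Suc_has_derivative smooth_onD by blast

lemma smooth_on_frechet: "smooth_on S f \<Longrightarrow> smooth_on S (\<lambda>x. frechet_derivative f (at x) v)"
  unfolding smooth_on_def by (metis Ck_on.simps(2))

lemma smooth_on_subset: "smooth_on S f \<Longrightarrow> T \<subseteq> S \<Longrightarrow> smooth_on T f"
  by (auto simp: smooth_on_def intro: Ck_on_subset)

lemma smooth_on_powr:
  shows "smooth_on {0<..} (\<lambda>x::real. x powr a)"
proof -
  \<comment> \<open>The factor c keeps the family closed under differentiation: c x^a becomes (c a)
    x^(a - 1).\<close>
  have "Ck_on k {0<..} (\<lambda>x. c * x powr a)" for k and c :: real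
  proof (induction k arbitrary: a c)
    case 0
    show ?case by (auto intro!: continuous_intros)
  next
    case (Suc k)
    show ?case
    proof (rule Ck_on_SucI)
      fix x :: real assume x: "x \<in> {0<..}"
      show "((\<lambda>x. c * x powr a) has_derivative (\<lambda>v. (v * c * a) * x powr (a - 1))) (at x)"
        using x by (auto intro!: derivative_eq_intros simp: powr_diff field_simps)
    qed (use Suc in auto)
  qed
  from this[of _ 1] show ?thesis by (simp add: smooth_on_def)
qed

subsection \<open>Fixed points depending on a parameter\<close>

text \<open>Implicit differentiation of a fixed point. The increment h of \<open>y\<close> satisfies
  h = L h + B d up to a small multiple of |d| + |h|. As 1 - L is invertible, this bound for one
  fixed e makes \<open>y\<close> Lipschitz at \<open>q\<close>; then |h| is absorbed into |d|, and
  the derivative is (1 - L)^(-1) B. Stating the remainder for increments lets the lemma serve linear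
  and nonlinear equations alike.\<close>

lemma fixpoint_has_derivative:
  fixes y :: "'q::real_normed_vector \<Rightarrow> 'e::banach" and L :: "'e \<Rightarrow>\<^sub>L 'e"
  assumes "bounded_linear B" "norm L \<le> \<kappa>" "\<kappa> < 1"
    and rem: "\<And>e. e > 0 \<Longrightarrow> \<forall>\<^sub>F q' in at q.
       norm (y q' - y q - L (y q' - y q) - B (q' - q)) \<le> e * (norm (q' - q) + norm (y q' - y q))"
  shows "\<exists>Y. (y has_derivative Y) (at q) \<and> (\<forall>v. Y v = L (Y v) + B v)"
proof -
  have \<kappa>0: "0 \<le> \<kappa>" using assms(2) norm_ge_zero order_trans by blast
  have Lk: "norm (L h) \<le> \<kappa> * norm h" for h
    using norm_blinfun[of L h] mult_right_mono[OF assms(2), of "norm h"] by simp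
  have est: "(1 - \<kappa>) * norm h \<le> norm (h - L h)" for h
    using Lk[of h] norm_triangle_ineq2[of h "L h"] by (simp add: algebra_simps)
  have ex: "\<exists>!z. L z + b = z" for b
  proof -
    have "dist (L z + b) (L z' + b) \<le> \<kappa> * dist z z'" for z z'
      using Lk[of "z - z'"] by (simp add: dist_norm blinfun.diff_right)
    then show ?thesis
      using banach_fix_type[of \<kappa> "\<lambda>z. L z + b"] \<kappa>0 assms(3) by auto
  qed
  \<comment> \<open>\<open>R\<close> is the inverse of 1 - L, of norm at most 1 / (1 -
    \<kappa>).\<close>
  define R where "R b = (THE z. L z + b = z)" for b
  have R: "L (R b) + b = R b" for b
    unfolding R_def using theI'[OF ex[of b]] .
  have Ru: "R b = z" if "L z + b = z" for b z
    using ex[of b] R[of b] that by blast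
  have Rlin: "bounded_linear R"
  proof (rule bounded_linear_intro[where K = "1 / (1 - \<kappa>)"])
    show "R (b + c) = R b + R c" for b c
      using arg_cong2[where f="(+)", OF R[of b] R[of c]]
      by (intro Ru) (simp add: blinfun.add_right add_ac)
    show "R (r *\<^sub>R b) = r *\<^sub>R R b" for r b
      using arg_cong[where f="\<lambda>x. r *\<^sub>R x", OF R[of b]]
      by (intro Ru) (simp add: blinfun.scaleR_right scaleR_add_right)
    show "norm (R b) \<le> norm b * (1 / (1 - \<kappa>))" for b
    proof -
      have "R b - L (R b) = b" using R[of b] by (metis add_diff_cancel_left')
      then have "(1 - \<kappa>) * norm (R b) \<le> norm b" using est[of "R b"] by metis
      then show ?thesis using assms(3) by (simp add: pos_le_divide_eq mult.commute)
    qed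
  qed
  define Y where "Y v = R (B v)" for v
  have Y: "Y v = L (Y v) + B v" for v unfolding Y_def using R by simp
  have Ylin: "bounded_linear Y"
    unfolding Y_def using bounded_linear_compose[OF Rlin assms(1)] by simp
  obtain CB where CB: "CB > 0" "\<And>v. norm (B v) \<le> norm v * CB"
    using bounded_linear.pos_bounded[OF assms(1)] by blast
  define C where "C = (1 / 2 * (1 - \<kappa>) + CB) / (1 / 2 * (1 - \<kappa>))"
  have Cpos: "C > 0" unfolding C_def using CB(1) assms(3) by (auto intro!: divide_pos_pos add_pos_pos)
  have lip: "\<forall>\<^sub>F q' in at q. norm (y q' - y q) \<le> C * norm (q' - q)"
  proof -
    \<comment> \<open>With half of the gap 1 - \<kappa> as e, the error in |h| consumes only half of
      the left-hand side, and a bound of |h| by |d| is left.\<close>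
    have "0 < 1 / 2 * (1 - \<kappa>)" using assms(3) by simp
    from rem[OF this] show ?thesis
    proof eventually_elim
      case (elim q')
      let ?h = "y q' - y q" and ?d = "q' - q"
      have "norm (?h - L ?h) \<le> norm (?h - L ?h - B ?d) + norm (B ?d)"
        by (metis diff_add_cancel norm_triangle_ineq)
      then have "(1 - \<kappa>) * norm ?h \<le> (1 - \<kappa>) * (norm ?d + norm ?h) / 2 + norm ?d * CB"
        using elim est[of ?h] CB(2)[of ?d] by linarith
      moreover have "(1 - \<kappa>) * (norm ?d + norm ?h) / 2 = 1 / 2 * (1 - \<kappa>) * norm ?d + 1 / 2 * (1 - \<kappa>) * norm ?h"
        by (simp add: field_simps)
      moreover have "(1 - \<kappa>) * norm ?h = 1 / 2 * (1 - \<kappa>) * norm ?h + 1 / 2 * (1 - \<kappa>) * norm ?h"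
        by (simp add: field_simps)
      ultimately have "(1 / 2 * (1 - \<kappa>)) * norm ?h \<le> (1 / 2 * (1 - \<kappa>) + CB) * norm ?d"
        by (simp only: distrib_right mult.commute[of "norm ?d" CB])
      moreover have aux: "x \<le> X / c * d" if "c * x \<le> X * d" "0 < c" for c x X d :: real
        using that by (simp add: field_simps)
      ultimately show ?case unfolding C_def using assms(3) by (intro aux) auto
    qed
  qed
  have "(y has_derivative Y) (at q)"
    unfolding has_derivative_at_alt
  proof (intro conjI allI impI Ylin)
    fix e :: real assume e: "e > 0"
    define e' where "e' = e * (1 - \<kappa>) / (1 + C)"
    have "e' > 0" unfolding e'_def using e Cpos assms(3) by auto
    have ev: "\<forall>\<^sub>F q' in at q. norm (y q' - y q - Y (q' - q)) \<le> e * norm (q' - q)"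
      using rem[OF \<open>e' > 0\<close>] lip
    proof eventually_elim
      case (elim q')
      let ?h = "y q' - y q" and ?d = "q' - q"
      have eq: "(?h - Y ?d) - L (?h - Y ?d) = ?h - L ?h - B ?d"
        using Y[of ?d] by (simp add: blinfun.diff_right blinfun.add_right algebra_simps)
      have "(1 - \<kappa>) * norm (?h - Y ?d) \<le> e' * (norm ?d + norm ?h)"
        using est[of "?h - Y ?d"] elim(1) unfolding eq by simp
      also have "\<dots> \<le> e' * ((1 + C) * norm ?d)"
        using elim(2) \<open>e' > 0\<close> by (intro mult_left_mono) (auto simp: algebra_simps)
      also have "\<dots> = (1 - \<kappa>) * (e * norm ?d)"
        unfolding e'_def using Cpos by (simp add: field_simps)
      finally show ?case using assms(3) by simp
    qed
    then obtain d where "d > 0" "\<And>q'. q' \<noteq> q \<Longrightarrow> dist q' q < d \<Longrightarrow> norm (y q' - y q - Y (q' - q)) \<le> e * norm (q' - q)"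
      unfolding eventually_at by auto
    then show "\<exists>d>0. \<forall>ya. norm (ya - q) < d \<longrightarrow> norm (y ya - y q - Y (ya - q)) \<le> e * norm (ya - q)"
    proof (intro exI[of _ d] conjI allI impI)
      fix ya assume "norm (ya - q) < d"
      then show "norm (y ya - y q - Y (ya - q)) \<le> e * norm (ya - q)" if "\<And>q'. q' \<noteq> q \<Longrightarrow> dist q' q < d \<Longrightarrow> norm (y q' - y q - Y (q' - q)) \<le> e * norm (q' - q)"
        using that[of ya] linear_0[OF bounded_linear.linear[OF Ylin]] by (cases "ya = q") (auto simp: dist_norm)
    qed auto
  qed
  then show ?thesis using Y by blast
qed

text \<open>Differentiating z = L z + b in direction v gives the same equation for the derivative,
  with the same \<open>L\<close> and with b' v + (L' v) z in place of \<open>b\<close>. Hence the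
  induction generalises over \<open>z\<close> and \<open>b\<close>, while \<open>S\<close> and
  \<kappa> are the same for every order.\<close>

lemma Ck_on_linear_fixpoint:
  fixes z b :: "'q::real_normed_vector \<Rightarrow> 'e::banach" and L :: "'q \<Rightarrow> 'e \<Rightarrow>\<^sub>L 'e"
  assumes "open S" "Ck_on k S L" "Ck_on k S b" "\<kappa> < 1"
    and "\<And>q. q \<in> S \<Longrightarrow> norm (L q) \<le> \<kappa>"
    and "\<And>q. q \<in> S \<Longrightarrow> z q = L q (z q) + b q"
  shows "Ck_on k S z"
  using assms(2,3,6)
proof (induction k arbitrary: z b)
  case 0
  have "isCont z q" if q: "q \<in> S" for q
  proof -
    have LC: "isCont L q" and bC: "isCont b q"
      using 0 q assms(1) continuous_on_eq_continuous_at by auto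
    have "((\<lambda>q'. (norm (b q' - b q) + norm (L q' - L q) * norm (z q)) / (1 - \<kappa>)) \<longlongrightarrow>
        (norm (b q - b q) + norm (L q - L q) * norm (z q)) / (1 - \<kappa>)) (at q)"
      using LC bC unfolding isCont_def by (intro tendsto_intros) (use assms(4) in auto)
    then have lim: "((\<lambda>q'. (norm (b q' - b q) + norm (L q' - L q) * norm (z q)) / (1 - \<kappa>)) \<longlongrightarrow> 0) (at q)"
      by simp
    have "\<forall>\<^sub>F q' in at q. q' \<in> S"
      using q assms(1) by (simp add: eventually_at_topological) blast
    then have "\<forall>\<^sub>F q' in at q. norm (z q' - z q) \<le> (norm (b q' - b q) + norm (L q' - L q) * norm (z q)) / (1 - \<kappa>)"
    proof eventually_elim
      case (elim q')
      have "z q' - z q = L q' (z q' - z q) + (L q' - L q) (z q) + (b q' - b q)"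
        by (rule trans[OF arg_cong2[where f="(-)", OF 0(3)[OF elim] 0(3)[OF q]]])
          (simp add: blinfun.diff_right blinfun.diff_left)
      then have "norm (z q' - z q) \<le> norm (L q' (z q' - z q)) + norm ((L q' - L q) (z q)) + norm (b q' - b q)"
        using norm_triangle_ineq[of "L q' (z q' - z q) + (L q' - L q) (z q)" "b q' - b q"]
          norm_triangle_ineq[of "L q' (z q' - z q)" "(L q' - L q) (z q)"] by simp
      moreover have "norm (L q' (z q' - z q)) \<le> \<kappa> * norm (z q' - z q)"
        using norm_blinfun[of "L q'" "z q' - z q"] mult_right_mono[OF assms(5)[OF elim], of "norm (z q' - z q)"] by simp
      ultimately have "(1 - \<kappa>) * norm (z q' - z q) \<le> norm (b q' - b q) + norm (L q' - L q) * norm (z q)"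
        using norm_blinfun[of "L q' - L q" "z q"] by (simp add: algebra_simps)
      then show ?case using assms(4) by (simp add: field_simps)
    qed
    then show ?thesis
      unfolding isCont_def LIM_zero_iff[of z, symmetric] by (rule Lim_null_comparison[OF _ lim])
  qed
  then show ?case by (simp add: continuous_at_imp_continuous_on)
next
  case (Suc k)
  \<comment> \<open>The induction hypothesis is used twice: here for \<open>z\<close>, which occurs
    in the new inhomogeneous term, and at the end for the derivative of \<open>z\<close>.\<close>
  have zk: "Ck_on k S z"
    by (rule Suc.IH[OF Ck_on_SucD[OF Suc.prems(1)] Ck_on_SucD[OF Suc.prems(2)] Suc.prems(3)])
  define B where "B q v = frechet_derivative b (at q) v + frechet_derivative L (at q) v (z q)" for q v
  have Bk: "Ck_on k S (\<lambda>q. B q v)" for v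
    unfolding B_def
    by (intro Ck_on_add Ck_on_bounded_bilinear[OF bounded_bilinear_blinfun_apply] assms zk)
      (use Suc.prems in auto)
  have ex: "\<exists>Y. (z has_derivative Y) (at q) \<and> (\<forall>v. Y v = L q (Y v) + B q v)" if q: "q \<in> S" for q
  proof (rule fixpoint_has_derivative[OF _ assms(5)[OF q] assms(4)])
    have Ld: "(L has_derivative frechet_derivative L (at q)) (at q)"
      and bd: "(b has_derivative frechet_derivative b (at q)) (at q)"
      using Suc.prems(1,2) q Ck_on_Suc_has_derivative by blast+
    \<comment> \<open>Here \<open>z\<close> is frozen at its value at \<open>q\<close>. What this
      leaves over, (L q' - L q) (z q' - z q), is absorbed by the continuity of
      \<open>L\<close>.\<close>
    have g: "((\<lambda>q'. b q' + L q' (z q)) has_derivative B q) (at q)"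
      unfolding B_def
      by (rule derivative_eq_intros bd bounded_bilinear.FDERIV[OF bounded_bilinear_blinfun_apply Ld] | simp)+
    then show "bounded_linear (B q)" by (rule has_derivative_bounded_linear)
    fix e :: real assume e: "e > 0"
    have "\<forall>\<^sub>F q' in at q. norm (b q' + L q' (z q) - (b q + L q (z q)) - B q (q' - q)) \<le> e * norm (q' - q)"
      using g e unfolding has_derivative_at_alt eventually_at dist_norm by blast
    moreover have "isCont L q"
      using Ld has_derivative_continuous by blast
    then have "\<forall>\<^sub>F q' in at q. dist (L q') (L q) < e"
      unfolding isCont_def using e tendstoD by blast
    moreover have "\<forall>\<^sub>F q' in at q. q' \<in> S"
      using q assms(1) by (simp add: eventually_at_topological) blast
    ultimately show "\<forall>\<^sub>F q' in at q. norm (z q' - z q - L q (z q' - z q) - B q (q' - q))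
        \<le> e * (norm (q' - q) + norm (z q' - z q))"
    proof eventually_elim
      case (elim q')
      have "z q' - z q = L q' (z q') + b q' - (L q (z q) + b q)"
        using arg_cong2[where f="(-)", OF Suc.prems(3)[OF elim(3)] Suc.prems(3)[OF q]] .
      then have "z q' - z q - L q (z q' - z q) - B q (q' - q) =
          L q' (z q') + b q' - (L q (z q) + b q) - L q (z q' - z q) - B q (q' - q)"
        by (rule arg_cong)
      also have "\<dots> =
          (L q' - L q) (z q' - z q) + (b q' + L q' (z q) - (b q + L q (z q)) - B q (q' - q))"
        by (simp add: blinfun.diff_right blinfun.diff_left)
      also have "norm \<dots> \<le> norm (L q' - L q) * norm (z q' - z q) + e * norm (q' - q)"
        using elim(1) norm_blinfun[of "L q' - L q"] by (intro norm_triangle_mono) auto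
      also have "\<dots> \<le> e * norm (z q' - z q) + e * norm (q' - q)"
        using elim(2) by (intro add_right_mono mult_right_mono) (auto simp: dist_norm)
      finally show ?case by (simp add: algebra_simps)
    qed
  qed
  then obtain Y where Y: "\<And>q. q \<in> S \<Longrightarrow> (z has_derivative Y q) (at q)"
    "\<And>q v. q \<in> S \<Longrightarrow> Y q v = L q (Y q v) + B q v"
    by metis
  show ?case
  proof (rule Ck_on_SucI[OF assms(1) Y(1)])
    show "Ck_on k S (\<lambda>q. Y q v)" for v
      by (rule Suc.IH[OF _ Bk Y(2)]) (use Suc.prems(1) Ck_on_SucD in auto)
  qed
qed

text \<open>\<open>L\<close> and \<open>B\<close> are the partial derivatives of
  \<open>\<Phi>\<close> along the graph of \<open>y\<close>. The argument is a bootstrap: if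
  \<open>y\<close> is C^k then so are they, the derivative of \<open>y\<close> solves a linear
  fixed-point equation with C^k coefficients, and so \<open>y\<close> is C^(k+1).\<close>

lemma smooth_on_fixpoint:
  fixes y :: "'q::real_normed_vector \<Rightarrow> 'e::banach" and L :: "'q \<Rightarrow> 'e \<Rightarrow>\<^sub>L 'e"
  assumes "open S" "continuous_on S y" "\<kappa> < 1"
    and "\<And>q. q \<in> S \<Longrightarrow> norm (L q) \<le> \<kappa>"
    and \<Phi>: "\<And>q. q \<in> S \<Longrightarrow> (\<Phi> has_derivative (\<lambda>(v, h). L q h + B q v)) (at (q, y q))"
    and y: "\<And>q. q \<in> S \<Longrightarrow> y q = \<Phi> (q, y q)"
    and Lk: "\<And>k. Ck_on k S y \<Longrightarrow> Ck_on k S L"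
    and Bk: "\<And>k v. Ck_on k S y \<Longrightarrow> Ck_on k S (\<lambda>q. B q v)"
  shows "smooth_on S y"
proof -
  have ex: "\<exists>Y. (y has_derivative Y) (at q) \<and> (\<forall>v. Y v = L q (Y v) + B q v)" if q: "q \<in> S" for q
  proof (rule fixpoint_has_derivative[OF _ assms(4)[OF q] assms(3)])
    have *: "bounded_linear (\<lambda>(v, h). L q h + B q v)"
      using \<Phi>[OF q] by (rule has_derivative_bounded_linear)
    have "bounded_linear (\<lambda>v. (\<lambda>(v, h). L q h + B q v) (v, 0))"
      by (rule bounded_linear_compose[OF *]) (auto intro!: bounded_linear_intros)
    then show "bounded_linear (B q)"
      by (simp add: blinfun.zero_right)
    fix e :: real assume e: "e > 0"
    have "\<forall>\<^sub>F p in nhds (q, y q). norm (\<Phi> p - \<Phi> (q, y q) - (case p - (q, y q) of (v, h) \<Rightarrow> L q h + B q v)) \<le> e * norm (p - (q, y q))"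
      using \<Phi>[OF q] e unfolding has_derivative_at_alt eventually_nhds_metric dist_norm by blast
    moreover have "filterlim (\<lambda>q'. (q', y q')) (nhds (q, y q)) (at q)"
      using assms(2) q assms(1) by (intro tendsto_Pair) (auto simp: continuous_on_eq_continuous_at isCont_def)
    ultimately have "\<forall>\<^sub>F q' in at q. norm (\<Phi> (q', y q') - \<Phi> (q, y q) - (case (q', y q') - (q, y q) of (v, h) \<Rightarrow> L q h + B q v)) \<le> e * norm ((q', y q') - (q, y q))"
      unfolding filterlim_iff by auto
    moreover have "\<forall>\<^sub>F q' in at q. q' \<in> S"
      using q assms(1) by (simp add: eventually_at_topological) blast
    ultimately show "\<forall>\<^sub>F q' in at q. norm (y q' - y q - L q (y q' - y q) - B q (q' - q))
        \<le> e * (norm (q' - q) + norm (y q' - y q))"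
    proof eventually_elim
      case (elim q')
      have "norm (y q' - y q - L q (y q' - y q) - B q (q' - q)) \<le> e * norm (q' - q, y q' - y q)"
        using elim(1) unfolding y[OF q, symmetric] y[OF elim(2), symmetric]
        by (simp add: algebra_simps)
      also have "\<dots> \<le> e * (norm (q' - q) + norm (y q' - y q))"
        using e norm_Pair_le[of "q' - q" "y q' - y q"] by (intro mult_left_mono) auto
      finally show ?case .
    qed
  qed
  then obtain Y where Y: "\<And>q. q \<in> S \<Longrightarrow> (y has_derivative Y q) (at q)"
    "\<And>q v. q \<in> S \<Longrightarrow> Y q v = L q (Y q v) + B q v"
    by metis
  have "Ck_on k S y" for k
  proof (induction k)
    case 0
    show ?case using assms(2) by simp
  next
    case (Suc k)
    show ?case
    proof (rule Ck_on_SucI[OF assms(1) Y(1)])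
      show "Ck_on k S (\<lambda>q. Y q v)" for v
        by (rule Ck_on_linear_fixpoint[OF assms(1) Lk[OF Suc] Bk[OF Suc] assms(3,4) Y(2)])
    qed
  qed
  then show ?thesis by (simp add: smooth_on_def)
qed

text \<open>The displacement (1 - \<kappa>) r of the centre and the contracted radius \<kappa> r add
  up to r, so the ball is mapped into itself. Uniqueness within the ball is recorded because the
  semigroup law of the flow rests on it.\<close>

lemma param_contraction:
  fixes \<Phi> :: "'q::metric_space \<Rightarrow> 'e::banach \<Rightarrow> 'e"
  assumes "0 < r" "0 \<le> \<kappa>" "\<kappa> < 1"
    and lip: "\<And>q x y. q \<in> S \<Longrightarrow> x \<in> cball y0 r \<Longrightarrow> y \<in> cball y0 r \<Longrightarrow> dist (\<Phi> q x) (\<Phi> q y) \<le> \<kappa> * dist x y"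
    and near: "\<And>q. q \<in> S \<Longrightarrow> dist (\<Phi> q y0) y0 \<le> (1 - \<kappa>) * r"
    and cont: "\<And>y. y \<in> cball y0 r \<Longrightarrow> continuous_on S (\<lambda>q. \<Phi> q y)"
  obtains y where "\<And>q. q \<in> S \<Longrightarrow> y q \<in> cball y0 r" "\<And>q. q \<in> S \<Longrightarrow> \<Phi> q (y q) = y q"
    "\<And>q z. q \<in> S \<Longrightarrow> z \<in> cball y0 r \<Longrightarrow> \<Phi> q z = z \<Longrightarrow> z = y q"
    "continuous_on S y"
proof -
  have y0: "y0 \<in> cball y0 r" using assms(1) by simp
  have ex: "\<exists>!z. z \<in> cball y0 r \<and> \<Phi> q z = z" if q: "q \<in> S" for q
  proof (rule Banach_fix)
    show "\<Phi> q ` cball y0 r \<subseteq> cball y0 r"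
    proof (safe)
      fix x assume x: "x \<in> cball y0 r"
      have "dist y0 (\<Phi> q x) \<le> dist (\<Phi> q y0) y0 + dist (\<Phi> q y0) (\<Phi> q x)"
        by (metis dist_commute dist_triangle)
      also have "\<dots> \<le> (1 - \<kappa>) * r + \<kappa> * dist y0 x"
        using near[OF q] lip[OF q y0 x] by simp
      also have "\<dots> \<le> (1 - \<kappa>) * r + \<kappa> * r"
        using x assms(2) by (intro add_left_mono mult_left_mono) auto
      finally show "\<Phi> q x \<in> cball y0 r" by (simp add: algebra_simps)
    qed
    show "complete (cball y0 r)"
      by (simp add: complete_eq_closed)
    show "cball y0 r \<noteq> {}" using y0 by blast
  qed (use assms lip[OF q] in auto)
  define y where "y q = (THE z. z \<in> cball y0 r \<and> \<Phi> q z = z)" for q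
  have y: "y q \<in> cball y0 r \<and> \<Phi> q (y q) = y q" if "q \<in> S" for q
    unfolding y_def using theI'[OF ex[OF that]] .
  have "continuous_on S y"
    unfolding continuous_on_def
  proof
    fix q assume q: "q \<in> S"
    have "((\<lambda>q'. \<Phi> q' (y q)) \<longlongrightarrow> \<Phi> q (y q)) (at q within S)"
      using cont[of "y q"] y[OF q] q by (auto simp: continuous_on_def)
    then have "((\<lambda>q'. dist (\<Phi> q' (y q)) (y q) / (1 - \<kappa>)) \<longlongrightarrow> dist (\<Phi> q (y q)) (y q) / (1 - \<kappa>)) (at q within S)"
      using assms(3) by (intro tendsto_intros) auto
    then have lim: "((\<lambda>q'. dist (\<Phi> q' (y q)) (y q) / (1 - \<kappa>)) \<longlongrightarrow> 0) (at q within S)"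
      using y[OF q] by simp
    have "dist (y q') (y q) \<le> dist (\<Phi> q' (y q)) (y q) / (1 - \<kappa>)" if q': "q' \<in> S" for q'
    proof -
      have "dist (y q') (y q) \<le> dist (\<Phi> q' (y q')) (\<Phi> q' (y q)) + dist (\<Phi> q' (y q)) (y q)"
        using y[OF q'] by (metis dist_triangle)
      also have "\<dots> \<le> \<kappa> * dist (y q') (y q) + dist (\<Phi> q' (y q)) (y q)"
        using lip[OF q', of "y q'" "y q"] y[OF q] y[OF q'] by simp
      finally have "(1 - \<kappa>) * dist (y q') (y q) \<le> dist (\<Phi> q' (y q)) (y q)"
        by (simp add: algebra_simps)
      then show ?thesis using assms(3) by (simp add: pos_le_divide_eq mult.commute)
    qed
    then have "\<forall>\<^sub>F q' in at q within S. norm (dist (y q') (y q)) \<le> dist (\<Phi> q' (y q)) (y q) / (1 - \<kappa>)"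
      by (auto simp: eventually_at_filter)
    then show "(y \<longlongrightarrow> y q) (at q within S)"
      unfolding tendsto_dist_iff[of y] by (rule Lim_null_comparison[OF _ lim])
  qed
  with y that ex show ?thesis by blast
qed

subsection \<open>Superposition operators on bounded continuous functions\<close>

instance bcontfun :: (metric_space, banach) banach ..

text \<open>The Nemytskii operator. \<open>Bcontfun\<close> is meaningful only on bounded continuous
  functions; this is ensured below by keeping the curves in a compact set on which \<open>g\<close>
  is continuous.\<close>

definition superposition :: "('b::metric_space \<Rightarrow> 'c::metric_space) \<Rightarrow> ('r::topological_space \<Rightarrow>\<^sub>C 'b) \<Rightarrow> ('r \<Rightarrow>\<^sub>C 'c)"
  where "superposition g y = Bcontfun (\<lambda>s. g (y s))"

lemma apply_superposition:
  assumes "compact C" "continuous_on C g" "range (apply_bcontfun y) \<subseteq> C"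
  shows "apply_bcontfun (superposition g y) s = g (y s)"
proof -
  have "continuous_on UNIV (\<lambda>s. g (y s))"
    using continuous_on_compose2[OF assms(2) continuous_on_apply_bcontfun assms(3)] .
  moreover have "range (\<lambda>s. g (y s)) \<subseteq> g ` C"
    using assms(3) by auto
  then have "bounded (range (\<lambda>s. g (y s)))"
    using bounded_subset compact_imp_bounded compact_continuous_image assms(1,2) by metis
  ultimately show ?thesis
    unfolding superposition_def by (simp add: Bcontfun_inverse bcontfun_def)
qed

lemma continuous_on_superposition:
  assumes "compact C" "continuous_on C g"
  shows "continuous_on {y. range (apply_bcontfun y) \<subseteq> C} (superposition g)"
  unfolding continuous_on_iff
proof (intro ballI allI impI)
  fix y :: "'r::topological_space \<Rightarrow>\<^sub>C 'a" and e :: real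
  assume y: "y \<in> {y. range (apply_bcontfun y) \<subseteq> C}" and e: "0 < e"
  obtain d where d: "d > 0" "\<And>u v. u \<in> C \<Longrightarrow> v \<in> C \<Longrightarrow> dist u v < d \<Longrightarrow> dist (g u) (g v) < e / 2"
    using compact_uniformly_continuous[OF assms(2,1)] e unfolding uniformly_continuous_on_def
    by (metis half_gt_zero)
  have "dist (superposition g y') (superposition g y) < e" if y': "range (apply_bcontfun y') \<subseteq> C" "dist y' y < d" for y'
  proof -
    have "dist (superposition g y') (superposition g y) \<le> e / 2"
    proof (rule dist_bound)
      fix s
      have "dist (y' s) (y s) < d" using y'(2) dist_bounded le_less_trans by blast
      then have "dist (g (y' s)) (g (y s)) < e / 2"
        using y y'(1) by (intro d(2)) auto
      then show "dist (superposition g y' s) (superposition g y s) \<le> e / 2"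
        using y y' by (simp add: apply_superposition[OF assms])
    qed
    with e show ?thesis by simp
  qed
  with d(1) show "\<exists>d>0. \<forall>x'\<in>{y. range (apply_bcontfun y) \<subseteq> C}. dist x' y < d \<longrightarrow> dist (superposition g x') (superposition g y) < e"
    by blast
qed

text \<open>One column of a matrix acting on a curve \<open>h\<close>. The derivative of a
  superposition is a sum of such terms over the basis, in which \<open>G\<close> is the
  superposition of a partial derivative; as the columns are superpositions again, induction on the
  order closes.\<close>

definition inner_scale :: "'b::real_inner \<Rightarrow> ('r::topological_space \<Rightarrow>\<^sub>C 'c::real_normed_vector) \<Rightarrow> ('r \<Rightarrow>\<^sub>C 'b) \<Rightarrow> ('r \<Rightarrow>\<^sub>C 'c)"
  where "inner_scale b G h = Bcontfun (\<lambda>s. (h s \<bullet> b) *\<^sub>R G s)"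

lemma norm_inner_scaleR_le: "norm ((h \<bullet> b) *\<^sub>R G) \<le> norm h * norm b * norm G"
  using mult_right_mono[OF Cauchy_Schwarz_ineq2[of h b] norm_ge_zero[of G]] by simp

lemma apply_inner_scale: "apply_bcontfun (inner_scale b G h) s = (h s \<bullet> b) *\<^sub>R G s"
proof -
  have "(\<lambda>s. (h s \<bullet> b) *\<^sub>R G s) \<in> bcontfun"
  proof (rule bcontfun_normI[where b = "norm h * norm b * norm G"])
    show "continuous_on UNIV (\<lambda>s. (h s \<bullet> b) *\<^sub>R G s)"
      by (intro continuous_intros) auto
    show "norm ((h s \<bullet> b) *\<^sub>R G s) \<le> norm h * norm b * norm G" for s
      using norm_inner_scaleR_le[of "h s" b "G s"]
        mult_mono[OF mult_right_mono[OF norm_bounded[of h s] norm_ge_zero[of b]] norm_bounded[of G s]]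
      by (simp add: order_trans)
  qed
  then show ?thesis unfolding inner_scale_def by (simp add: Bcontfun_inverse)
qed

lemma norm_inner_scale_le: "norm (inner_scale b G h) \<le> norm G * norm h * norm b"
proof (rule norm_bound)
  show "norm (inner_scale b G h s) \<le> norm G * norm h * norm b" for s
    unfolding apply_inner_scale
    using norm_inner_scaleR_le[of "h s" b "G s"]
      mult_mono[OF mult_right_mono[OF norm_bounded[of h s] norm_ge_zero[of b]] norm_bounded[of G s]]
    by (simp add: order_trans mult.commute mult.left_commute)
qed

lemma bounded_bilinear_inner_scale: "bounded_bilinear (inner_scale b)"
  by standard
    (auto intro!: bcontfun_eqI norm_inner_scale_le simp: apply_inner_scale inner_add_left scaleR_add_left scaleR_add_right)

text \<open>The pointwise remainder must be small uniformly along the curve. The partial derivatives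
  of \<open>g\<close> are uniformly continuous on the compact ball of radius \<open>R\<close>, and R
  - r is the room needed for the curves near \<open>y\<close>.\<close>

lemma superposition_has_derivative:
  fixes g :: "'b::euclidean_space \<Rightarrow> 'c::real_normed_vector" and y :: "'r::topological_space \<Rightarrow>\<^sub>C 'b"
  assumes g: "Ck_on (Suc 0) T g" and "r < R" "cball a R \<subseteq> T"
    and y: "range (apply_bcontfun y) \<subseteq> cball a r"
  shows "(superposition g has_derivative (\<lambda>h. \<Sum>b\<in>Basis. inner_scale b (superposition (\<lambda>z. frechet_derivative g (at z) b) y) h)) (at y)"
    (is "(_ has_derivative ?D) _")
  unfolding has_derivative_at_alt
proof (intro conjI allI impI)
  show "bounded_linear ?D"
    by (intro bounded_linear_sum bounded_bilinear.bounded_linear_right[OF bounded_bilinear_inner_scale])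
  fix e :: real assume e: "e > 0"
  let ?g' = "\<lambda>z. frechet_derivative g (at z)"
  have gd: "(g has_derivative ?g' z) (at z)" if "z \<in> T" for z
    using Ck_on_Suc_has_derivative[OF g that] .
  have cg: "continuous_on (cball a R) g"
    using Ck_on_continuous[OF g] assms(3) continuous_on_subset by blast
  have cg': "continuous_on (cball a R) (\<lambda>z. ?g' z b)" for b
    by (rule continuous_on_subset[OF _ assms(3)]) (use g in auto)
  \<comment> \<open>One share for each partial derivative; the shares add up to
    \<open>e\<close>.\<close>
  define \<epsilon> where "\<epsilon> = e / real DIM('b)"
  have "\<epsilon> > 0" using e by (simp add: \<epsilon>_def)
  have "\<exists>d>0. \<forall>u\<in>cball a R. \<forall>v\<in>cball a R. dist u v < d \<longrightarrow> norm (?g' u b - ?g' v b) < \<epsilon>" for b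
    using compact_uniformly_continuous[OF cg'[of b]] \<open>\<epsilon> > 0\<close>
    unfolding uniformly_continuous_on_def dist_norm by (metis compact_cball dist_commute dist_norm)
  then obtain d where d: "\<And>b. d b > 0"
    "\<And>b u v. u \<in> cball a R \<Longrightarrow> v \<in> cball a R \<Longrightarrow> dist u v < d b \<Longrightarrow> norm (?g' u b - ?g' v b) < \<epsilon>"
    by metis
  \<comment> \<open>R - r keeps the perturbed points in the large ball. The factor 1 / 2 makes
    \<open>\<delta>\<close> strictly smaller than each modulus \<open>d b\<close>, since closed
    balls of radius \<open>\<delta>\<close> are used.\<close>
  define \<delta> where "\<delta> = min (R - r) (Min (d ` Basis) / 2)"
  have \<delta>: "\<delta> > 0" "\<delta> \<le> R - r" "\<And>b. b \<in> Basis \<Longrightarrow> \<delta> < d b"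
  proof -
    have *: "Min (d ` Basis) > 0" using d(1) by (subst Min_gr_iff) auto
    then show "\<delta> > 0" "\<delta> \<le> R - r" using assms(2) by (auto simp: \<delta>_def)
    show "\<delta> < d b" if "b \<in> Basis" for b
    proof -
      have "Min (d ` Basis) \<le> d b" using that by (intro Min_le) auto
      with * show ?thesis unfolding \<delta>_def by linarith
    qed
  qed
  have key: "norm (g u - g v - ?g' v (u - v)) \<le> norm (u - v) * e"
    if v: "v \<in> cball a r" and u: "dist v u \<le> \<delta>" for u v
  proof (rule differentiable_bound_linearization[where S = "cball v \<delta>"])
    have sub: "cball v \<delta> \<subseteq> cball a R"
      using v \<delta>(2) by (subst cball_subset_cball_iff) (auto simp: dist_commute)
    show "v + t *\<^sub>R (u - v) \<in> cball v \<delta>" if "t \<in> {0..1}" for t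
    proof -
      have "norm (t *\<^sub>R (u - v)) \<le> 1 * norm (u - v)"
        using that unfolding norm_scaleR by (intro mult_right_mono) auto
      then show ?thesis using u by (simp add: dist_norm norm_minus_commute)
    qed
    show "(g has_derivative ?g' x) (at x within cball v \<delta>)" if "x \<in> cball v \<delta>" for x
      using gd sub assms(3) that has_derivative_at_withinI by blast
    show "v \<in> cball v \<delta>" using \<delta>(1) by simp
    show "onorm (?g' x - ?g' v) \<le> e" if x: "x \<in> cball v \<delta>" for x
    proof (rule onorm_le)
      fix h
      have lin: "linear (?g' z)" if "z \<in> cball a R" for z
        using has_derivative_linear[OF gd] that assms(3) by blast
      have xv: "x \<in> cball a R" "v \<in> cball a R"
        using sub x v assms(2) by auto
      have "(?g' x - ?g' v) h = (\<Sum>b\<in>Basis. (h \<bullet> b) *\<^sub>R (?g' x b - ?g' v b))"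
        using linear_euclidean_sum[OF lin[OF xv(1)], of h] linear_euclidean_sum[OF lin[OF xv(2)], of h]
        by (simp add: scaleR_diff_right sum_subtractf)
      also have "norm \<dots> \<le> (\<Sum>b\<in>(Basis::'b set). norm h * \<epsilon>)"
      proof (rule sum_norm_le)
        fix b :: 'b assume b: "b \<in> Basis"
        have "norm (?g' x b - ?g' v b) < \<epsilon>"
          using x \<delta>(3)[OF b] by (intro d(2) xv) (auto simp: dist_commute)
        then show "norm ((h \<bullet> b) *\<^sub>R (?g' x b - ?g' v b)) \<le> norm h * \<epsilon>"
          unfolding norm_scaleR using Basis_le_norm[OF b, of h] by (intro mult_mono) auto
      qed
      also have "\<dots> = e * norm h" by (simp add: \<epsilon>_def)
      finally show "norm ((?g' x - ?g' v) h) \<le> e * norm h" .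
    qed
  qed
  show "\<exists>d>0. \<forall>y'. norm (y' - y) < d \<longrightarrow> norm (superposition g y' - superposition g y - ?D (y' - y)) \<le> e * norm (y' - y)"
  proof (intro exI[of _ \<delta>] conjI allI impI \<delta>(1))
    fix y' assume y': "norm (y' - y) < \<delta>"
    have d': "dist (y s) (y' s) \<le> \<delta>" for s
      using dist_bounded[of y s y'] y' by (simp add: dist_norm norm_minus_commute)
    have "y' s \<in> cball a R" for s
    proof -
      have "y s \<in> cball a r" using y by blast
      then show ?thesis
        using d'[of s] \<delta>(2) dist_triangle[of a "y' s" "y s"] by simp
    qed
    then have ry': "range (apply_bcontfun y') \<subseteq> cball a R" by auto
    have ry: "range (apply_bcontfun y) \<subseteq> cball a R" using y assms(2) by (auto simp: subset_iff)
    show "norm (superposition g y' - superposition g y - ?D (y' - y)) \<le> e * norm (y' - y)"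
    proof (rule norm_bound)
      fix s
      have "apply_bcontfun (?D (y' - y)) s = (\<Sum>b\<in>Basis. ((y' s - y s) \<bullet> b) *\<^sub>R ?g' (y s) b)"
      proof -
        have "apply_bcontfun (\<Sum>b\<in>B. f b) s = (\<Sum>b\<in>B. apply_bcontfun (f b) s)" for f :: "'b \<Rightarrow> 'r \<Rightarrow>\<^sub>C 'c" and B
          by (induction B rule: infinite_finite_induct) auto
        then show ?thesis
          by (simp add: apply_inner_scale apply_superposition[OF compact_cball cg' ry])
      qed
      also have "\<dots> = ?g' (y s) (y' s - y s)"
        using ry assms(3) by (intro linear_euclidean_sum[OF has_derivative_linear[OF gd], symmetric]) auto
      finally have "apply_bcontfun (superposition g y' - superposition g y - ?D (y' - y)) s = g (y' s) - g (y s) - ?g' (y s) (y' s - y s)"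
        by (simp add: apply_superposition[OF compact_cball cg ry] apply_superposition[OF compact_cball cg ry'])
      also have "norm \<dots> \<le> norm (y' s - y s) * e"
        using y d' by (intro key) blast+
      also have "\<dots> \<le> norm (y' - y) * e"
        using norm_bounded[of "y' - y" s] e by (intro mult_right_mono) auto
      finally show "norm (apply_bcontfun (superposition g y' - superposition g y - ?D (y' - y)) s) \<le> e * norm (y' - y)"
        by (simp add: mult.commute)
    qed
  qed
qed

lemma Ck_on_superposition:
  fixes g :: "'b::euclidean_space \<Rightarrow> 'c::real_normed_vector"
    and y :: "'q::real_normed_vector \<Rightarrow> 'r::topological_space \<Rightarrow>\<^sub>C 'b"
  assumes "open S" "open T" "Ck_on k S y" "Ck_on k T g" "r < R" "cball a R \<subseteq> T"
    and "\<And>q. q \<in> S \<Longrightarrow> range (apply_bcontfun (y q)) \<subseteq> cball a r"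
  shows "Ck_on k S (\<lambda>q. superposition g (y q))"
  using assms(3,4)
proof (induction k arbitrary: g)
  case 0
  have sub: "cball a r \<subseteq> cball a R" using assms(5) by (auto simp: subset_iff)
  have "continuous_on (cball a r) g"
    by (rule continuous_on_subset[OF _ order_trans[OF sub assms(6)]]) (use 0 in auto)
  from continuous_on_superposition[OF compact_cball this] show ?case
    using 0 assms(7) by (auto intro: continuous_on_compose2)
next
  case (Suc k)
  have g0: "Ck_on (Suc 0) T g"
    using Suc.prems(2) by (auto intro: Ck_on_continuous)
  show ?case
  proof (rule Ck_on_SucI[OF assms(1)])
    fix q assume q: "q \<in> S"
    show "((\<lambda>q. superposition g (y q)) has_derivative (\<lambda>v. \<Sum>b\<in>Basis. inner_scale b (superposition (\<lambda>z. frechet_derivative g (at z) b) (y q))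
        (frechet_derivative y (at q) v))) (at q)"
      using has_derivative_compose[OF Ck_on_Suc_has_derivative[OF Suc.prems(1) q]
          superposition_has_derivative[OF g0 assms(5) assms(6) assms(7)[OF q]]] .
  next
    fix v
    show "Ck_on k S (\<lambda>q. \<Sum>b\<in>Basis. inner_scale b (superposition (\<lambda>z. frechet_derivative g (at z) b) (y q))
        (frechet_derivative y (at q) v))"
      by (intro Ck_on_sum assms Ck_on_bounded_bilinear[OF bounded_bilinear_inner_scale] Suc.IH)
        (use Suc.prems Ck_on_SucD in auto)
  qed
qed

subsection \<open>Germs of smooth functions\<close>

definition smooth_near :: "'a::real_normed_vector \<Rightarrow> ('a \<Rightarrow> 'b::real_normed_vector) \<Rightarrow> bool"
  where "smooth_near a f \<longleftrightarrow> (\<exists>S. open S \<and> a \<in> S \<and> smooth_on S f)"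

lemma smooth_nearI: "open S \<Longrightarrow> a \<in> S \<Longrightarrow> smooth_on S f \<Longrightarrow> smooth_near a f"
  by (auto simp: smooth_near_def)

lemma smooth_near_const [simp]: "smooth_near a (\<lambda>x. c)"
  by (rule smooth_nearI[of UNIV]) (auto simp: smooth_on_def)

lemma smooth_near_ident: "smooth_near a (\<lambda>x. x)"
  by (rule smooth_nearI[of UNIV]) (auto simp: smooth_on_def intro: Ck_on_ident)

lemma smooth_near_bounded_linear_comp:
  assumes "bounded_linear h" "smooth_near a f"
  shows "smooth_near a (\<lambda>x. h (f x))"
  using assms Ck_on_bounded_linear_comp unfolding smooth_near_def smooth_on_def by metis

lemma smooth_near_bounded_linear: "bounded_linear h \<Longrightarrow> smooth_near a h"
  using smooth_near_bounded_linear_comp smooth_near_ident by blast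

lemma smooth_near_Int2:
  assumes "smooth_near a f" "smooth_near a g"
  obtains S where "open S" "a \<in> S" "smooth_on S f" "smooth_on S g"
proof -
  obtain S T where "open S" "a \<in> S" "smooth_on S f" "open T" "a \<in> T" "smooth_on T g"
    using assms unfolding smooth_near_def by metis
  then show ?thesis
    using that[of "S \<inter> T"] smooth_on_subset[of S f "S \<inter> T"] smooth_on_subset[of T g "S \<inter> T"] by auto
qed

lemma smooth_near_add:
  assumes "smooth_near a f" "smooth_near a g"
  shows "smooth_near a (\<lambda>x. f x + g x)"
  using smooth_near_Int2[OF assms] Ck_on_add unfolding smooth_on_def smooth_near_def by metis

lemma smooth_near_bounded_bilinear:
  assumes "bounded_bilinear h" "smooth_near a f" "smooth_near a g"
  shows "smooth_near a (\<lambda>x. h (f x) (g x))"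
  using smooth_near_Int2[OF assms(2,3)] Ck_on_bounded_bilinear[OF assms(1)]
  unfolding smooth_on_def smooth_near_def by metis

lemma smooth_near_minus: "smooth_near a f \<Longrightarrow> smooth_near a (\<lambda>x. - f x)"
  using smooth_near_bounded_linear_comp[OF bounded_linear_minus[OF bounded_linear_ident]] by blast

lemma smooth_near_diff: "smooth_near a f \<Longrightarrow> smooth_near a g \<Longrightarrow> smooth_near a (\<lambda>x. f x - g x)"
  using smooth_near_add[of a f "\<lambda>x. - g x"] smooth_near_minus by auto

lemma smooth_near_mult:
  fixes f :: "'a::real_normed_vector \<Rightarrow> 'b::real_normed_algebra"
  shows "smooth_near a f \<Longrightarrow> smooth_near a g \<Longrightarrow> smooth_near a (\<lambda>x. f x * g x)"
  using smooth_near_bounded_bilinear[OF bounded_bilinear_mult] .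

lemma smooth_near_scaleR: "smooth_near a f \<Longrightarrow> smooth_near a g \<Longrightarrow> smooth_near a (\<lambda>x. f x *\<^sub>R g x)"
  using smooth_near_bounded_bilinear[OF bounded_bilinear_scaleR] .

lemma smooth_near_power:
  fixes f :: "'a::real_normed_vector \<Rightarrow> 'b::real_normed_algebra_1"
  shows "smooth_near a f \<Longrightarrow> smooth_near a (\<lambda>x. f x ^ k)"
  by (induction k) (auto intro: smooth_near_mult)

lemma smooth_near_fst: "smooth_near a f \<Longrightarrow> smooth_near a (\<lambda>x. fst (f x))"
  using smooth_near_bounded_linear_comp[OF bounded_linear_fst] .

lemma smooth_near_snd: "smooth_near a f \<Longrightarrow> smooth_near a (\<lambda>x. snd (f x))"
  using smooth_near_bounded_linear_comp[OF bounded_linear_snd] .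

lemma smooth_near_inner: "smooth_near a f \<Longrightarrow> smooth_near a (\<lambda>x. f x \<bullet> b)"
  using smooth_near_bounded_linear_comp[OF bounded_linear_inner_left] .

lemma smooth_near_Pair:
  assumes "smooth_near a f" "smooth_near a g"
  shows "smooth_near a (\<lambda>x. (f x, g x))"
proof -
  have "smooth_near a (\<lambda>x. (f x, 0) + (0, g x))"
    by (intro smooth_near_add smooth_near_bounded_linear_comp[OF bounded_linear_Pair[OF bounded_linear_ident bounded_linear_zero] assms(1)]
        smooth_near_bounded_linear_comp[OF bounded_linear_Pair[OF bounded_linear_zero bounded_linear_ident] assms(2)])
  then show ?thesis by simp
qed

lemma smooth_near_isCont: "smooth_near a f \<Longrightarrow> isCont f a"
  using Ck_on_continuous smooth_onD continuous_on_eq_continuous_at unfolding smooth_near_def by metis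

lemma smooth_near_compose:
  fixes f :: "'a::real_normed_vector \<Rightarrow> 'b::euclidean_space"
  assumes "smooth_near a f" "smooth_near (f a) g"
  shows "smooth_near a (\<lambda>x. g (f x))"
proof -
  obtain S T where ST: "open S" "a \<in> S" "smooth_on S f" "open T" "f a \<in> T" "smooth_on T g"
    using assms unfolding smooth_near_def by metis
  have "continuous_on S f" using ST(3) Ck_on_continuous smooth_onD by blast
  then have o: "open (S \<inter> f -` T)" using ST(1,4) continuous_open_preimage by blast
  have "Ck_on k (S \<inter> f -` T) (\<lambda>x. g (f x))" for k
    by (rule Ck_on_compose[OF o ST(4) _ Ck_on_subset[OF smooth_onD[OF ST(3)]] smooth_onD[OF ST(6)]]) auto
  with o ST show ?thesis by (intro smooth_nearI[of "S \<inter> f -` T"]) (auto simp: smooth_on_def)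
qed

lemma smooth_near_powr:
  fixes f :: "'a::real_normed_vector \<Rightarrow> real"
  assumes "smooth_near a f" "f a > 0"
  shows "smooth_near a (\<lambda>x. f x powr c)"
  by (rule smooth_near_compose[OF assms(1)], rule smooth_nearI[OF _ _ smooth_on_powr]) (use assms(2) in auto)

lemma smooth_near_frechet: "smooth_near a f \<Longrightarrow> smooth_near a (\<lambda>x. frechet_derivative f (at x) v)"
  using smooth_on_frechet unfolding smooth_near_def by blast

lemma smooth_near_has_derivative:
  assumes "smooth_near a f"
  shows "\<forall>\<^sub>F x in nhds a. (f has_derivative frechet_derivative f (at x)) (at x)"
  using assms smooth_on_has_derivative unfolding smooth_near_def eventually_nhds by blast

lemma smooth_near_has_derivative_at:
  "smooth_near a f \<Longrightarrow> (f has_derivative frechet_derivative f (at a)) (at a)"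
  using smooth_near_has_derivative eventually_nhds_x_imp_x by blast

lemmas smooth_near_intros = smooth_near_ident smooth_near_const smooth_near_add smooth_near_diff smooth_near_minus
  smooth_near_mult smooth_near_scaleR smooth_near_power smooth_near_fst smooth_near_snd smooth_near_inner smooth_near_Pair

text \<open>Curves near the constant curve \<open>p\<close> stay in a small ball about
  \<open>p\<close>, so a germ of \<open>F\<close> at \<open>p\<close> is enough. The second claim
  records that \<open>Bcontfun\<close> has its intended value there.\<close>

lemma smooth_near_superposition:
  fixes y :: "'q::real_normed_vector \<Rightarrow> 'r::topological_space \<Rightarrow>\<^sub>C 'b::euclidean_space"
    and F :: "'b \<Rightarrow> 'c::real_normed_vector"
  assumes y: "smooth_near a y" and F: "smooth_near p F" and ya: "y a = const_bcontfun p"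
  shows "smooth_near a (\<lambda>q. superposition F (y q))"
    and "\<forall>\<^sub>F q in nhds a. \<forall>s. apply_bcontfun (superposition F (y q)) s = F (y q s)"
proof -
  obtain T where T: "open T" "p \<in> T" "smooth_on T F"
    using F unfolding smooth_near_def by blast
  obtain R where R: "R > 0" "cball p R \<subseteq> T" using T open_contains_cball by blast
  obtain S0 where S0: "open S0" "a \<in> S0" "smooth_on S0 y" using y unfolding smooth_near_def by blast
  \<comment> \<open>Half the radius leaves the margin that differentiating a superposition
    requires.\<close>
  define S where "S = S0 \<inter> y -` ball (const_bcontfun p) (R / 2)"
  have cy: "continuous_on S0 y" using S0(3) Ck_on_continuous smooth_onD by blast
  have S: "open S" "a \<in> S" "smooth_on S y"
    unfolding S_def using continuous_open_preimage[OF cy S0(1)] S0 ya R(1)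
    by (auto intro: smooth_on_subset)
  have yS: "range (apply_bcontfun (y q)) \<subseteq> cball p (R / 2)" if "q \<in> S" for q
  proof -
    have "dist (const_bcontfun p) (y q) < R / 2" using that by (auto simp: S_def)
    then have "dist p (y q s) < R / 2" for s
      using dist_bounded[of "const_bcontfun p" s "y q"] by simp
    then show ?thesis unfolding image_subset_iff mem_cball by (meson less_imp_le)
  qed
  have "Ck_on k S (\<lambda>q. superposition F (y q))" for k
    by (rule Ck_on_superposition[OF S(1) T(1) smooth_onD[OF S(3)] smooth_onD[OF T(3)] _ R(2) yS]) (use R in auto)
  then show "smooth_near a (\<lambda>q. superposition F (y q))"
    using smooth_nearI[OF S(1,2), of "\<lambda>q. superposition F (y q)"] by (simp add: smooth_on_def)
  have "continuous_on (cball p (R / 2)) F"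
    by (rule continuous_on_subset[OF Ck_on_continuous[OF smooth_onD[OF T(3)]]])
      (rule order_trans[OF _ R(2)], use R in auto)
  then have "apply_bcontfun (superposition F (y q)) s = F (y q s)" if "q \<in> S" for q s
    using apply_superposition[OF compact_cball _ yS[OF that]] by blast
  then show "\<forall>\<^sub>F q in nhds a. \<forall>s. apply_bcontfun (superposition F (y q)) s = F (y q s)"
    unfolding eventually_nhds using S by blast
qed

text \<open>Composed with a curve that depends smoothly on a parameter, this functional takes the
  place of differentiation under the integral sign.\<close>

lemma bounded_linear_integral01:
  "bounded_linear (\<lambda>G. integral {0..1} (apply_bcontfun (G :: real \<Rightarrow>\<^sub>C real)))"
proof (rule bounded_linear_intro[where K = 1])
  have i: "apply_bcontfun G integrable_on {0..1}" for G :: "real \<Rightarrow>\<^sub>C real"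
    by (intro integrable_continuous_real) auto
  show "integral {0..1} (apply_bcontfun (G + H)) = integral {0..1} (apply_bcontfun G) + integral {0..1} (apply_bcontfun H)"
    for G H :: "real \<Rightarrow>\<^sub>C real"
    using integral_add[OF i i] by simp
  show "integral {0..1} (apply_bcontfun (r *\<^sub>R G)) = r *\<^sub>R integral {0..1} (apply_bcontfun G)" for G :: "real \<Rightarrow>\<^sub>C real" and r
    by simp
  show "norm (integral {0..1} (apply_bcontfun G)) \<le> norm G * 1" for G :: "real \<Rightarrow>\<^sub>C real"
    using integral_bound[of 0 1 "apply_bcontfun G" "norm G"] norm_bounded[of G] by auto
qed

text \<open>\<open>H b (u, v)\<close> is the mean of the partial derivative of \<open>R\<close> in
  direction \<open>b\<close> over the segment from \<open>v\<close> to \<open>u\<close>. It is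
  smooth in (u, v) because the segment, as an element of the space of bounded curves, depends
  linearly on its end points.\<close>

lemma hadamard:
  fixes R :: "'b::euclidean_space \<Rightarrow> real"
  assumes R: "smooth_near p R"
  shows "\<exists>H. (\<forall>b\<in>Basis. smooth_near (p, p) (H b)) \<and>
    (\<forall>\<^sub>F (u, v) in nhds (p, p). R u - R v = (\<Sum>b\<in>Basis. H b (u, v) * ((u - v) \<bullet> b)))"
proof -
  \<comment> \<open>The parameter of the segment, clamped to [0, 1] so that segments become bounded
    functions on all reals.\<close>
  define cl where "cl = Bcontfun (\<lambda>s::real. max 0 (min 1 s))"
  have "(\<lambda>s::real. max 0 (min 1 s)) \<in> bcontfun"
    by (rule bcontfun_normI[where b = 1]) (auto intro!: continuous_intros)
  then have cl: "apply_bcontfun cl s = max 0 (min 1 s)" for s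
    unfolding cl_def by (simp add: Bcontfun_inverse)
  \<comment> \<open>The clamped segment from \<open>snd q\<close> to \<open>fst q\<close>, written
    as a sum over the basis to make its linearity in \<open>q\<close> evident.\<close>
  define P :: "'b \<times> 'b \<Rightarrow> real \<Rightarrow>\<^sub>C 'b" where
    "P = (\<lambda>q. const_bcontfun (snd q) + (\<Sum>b\<in>Basis. ((fst q - snd q) \<bullet> b) *\<^sub>R inner_scale 1 (const_bcontfun b) cl))"
  have P: "apply_bcontfun (P q) s = snd q + max 0 (min 1 s) *\<^sub>R (fst q - snd q)" for q s
  proof -
    have "apply_bcontfun (\<Sum>b\<in>B. f b) s = (\<Sum>b\<in>B. apply_bcontfun (f b) s)" for f :: "'b \<Rightarrow> real \<Rightarrow>\<^sub>C 'b" and B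
      by (induction B rule: infinite_finite_induct) auto
    then have "apply_bcontfun (P q) s = snd q + (\<Sum>b\<in>Basis. max 0 (min 1 s) *\<^sub>R (((fst q - snd q) \<bullet> b) *\<^sub>R b))"
      unfolding P_def by (simp add: apply_inner_scale cl mult.commute)
    then show ?thesis
      by (simp only: scaleR_sum_right[symmetric] euclidean_representation)
  qed
  have bl: "bounded_linear (const_bcontfun :: 'b \<Rightarrow> real \<Rightarrow>\<^sub>C 'b)"
    by (rule bounded_linear_intro[where K = 1]) (auto intro!: bcontfun_eqI norm_bound)
  have "bounded_linear P"
    unfolding P_def
    by (intro bounded_linear_add bounded_linear_compose[OF bl] bounded_linear_sum
        bounded_linear_scaleR_const bounded_linear_compose[OF bounded_linear_inner_left]
        bounded_linear_sub bounded_linear_intros)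
  then have Ps: "smooth_near (p, p) P" by (rule smooth_near_bounded_linear)
  have Pp: "P (p, p) = const_bcontfun p" by (rule bcontfun_eqI) (simp add: P)
  define H where "H b q = integral {0..1} (apply_bcontfun (superposition (\<lambda>z. frechet_derivative R (at z) b) (P q)))" for b q
  have Hs: "smooth_near (p, p) (H b)" for b
    unfolding H_def
    by (intro smooth_near_bounded_linear_comp[OF bounded_linear_integral01]
        smooth_near_superposition(1)[OF Ps smooth_near_frechet[OF R] Pp])
  obtain T where T: "open T" "p \<in> T" "smooth_on T R" using R unfolding smooth_near_def by blast
  obtain r where r: "r > 0" "ball p r \<subseteq> T" using T open_contains_ball by blast
  have "\<forall>\<^sub>F q in nhds (p, p). \<forall>b\<in>Basis. \<forall>s. apply_bcontfun (superposition (\<lambda>z. frechet_derivative R (at z) b) (P q)) s = frechet_derivative R (at (P q s)) b"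
    by (intro eventually_ball_finite ballI smooth_near_superposition(2)[OF Ps smooth_near_frechet[OF R] Pp]) auto
  moreover have "\<forall>\<^sub>F q in nhds (p, p). q \<in> ball p r \<times> ball p r"
    using r(1) by (intro eventually_nhds_in_open) (auto intro: open_Times)
  ultimately have "\<forall>\<^sub>F q in nhds (p, p). R (fst q) - R (snd q) = (\<Sum>b\<in>Basis. H b q * ((fst q - snd q) \<bullet> b))"
  proof eventually_elim
    case (elim q)
    obtain u v where q: "q = (u, v)" by (cases q)
    have seg: "v + s *\<^sub>R (u - v) \<in> ball p r" if "s \<in> {0..1}" for s
    proof -
      have "(1 - s) *\<^sub>R v + s *\<^sub>R u \<in> ball p r"
        using elim(2) that unfolding q by (intro convexD[OF convex_ball]) auto
      then show ?thesis by (simp add: algebra_simps)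
    qed
    have Pq: "apply_bcontfun (P q) s = v + s *\<^sub>R (u - v)" if "s \<in> {0..1}" for s
      using that by (simp add: P q)
    have "((\<lambda>s. \<Sum>b\<in>Basis. superposition (\<lambda>z. frechet_derivative R (at z) b) (P q) s * ((u - v) \<bullet> b))
        has_integral R (v + 1 *\<^sub>R (u - v)) - R (v + 0 *\<^sub>R (u - v))) {0..1}"
    proof (rule fundamental_theorem_of_calculus)
      fix s :: real assume s: "s \<in> {0..1}"
      have d: "(R has_derivative frechet_derivative R (at (v + s *\<^sub>R (u - v)))) (at (v + s *\<^sub>R (u - v)))"
        using smooth_on_has_derivative[OF T(3)] seg[OF s] r(2) by blast
      have l: "((\<lambda>s. v + s *\<^sub>R (u - v)) has_derivative (\<lambda>h. h *\<^sub>R (u - v))) (at s within {0..1})"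
        by (auto intro!: derivative_eq_intros)
      have "((\<lambda>s. R (v + s *\<^sub>R (u - v))) has_derivative
          (\<lambda>h. frechet_derivative R (at (v + s *\<^sub>R (u - v))) (h *\<^sub>R (u - v)))) (at s within {0..1})"
        using has_derivative_compose[OF l d] .
      moreover have "frechet_derivative R (at (v + s *\<^sub>R (u - v))) (h *\<^sub>R (u - v)) =
          h *\<^sub>R (\<Sum>b\<in>Basis. superposition (\<lambda>z. frechet_derivative R (at z) b) (P q) s * ((u - v) \<bullet> b))" for h
        using elim(1) linear_euclidean_sum[OF has_derivative_linear[OF d], of "u - v"]
          linear_scale[OF has_derivative_linear[OF d], of h "u - v"]
        by (simp add: Pq[OF s] mult.commute)
      ultimately show "((\<lambda>s. R (v + s *\<^sub>R (u - v))) has_vector_derivative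
          (\<Sum>b\<in>Basis. superposition (\<lambda>z. frechet_derivative R (at z) b) (P q) s * ((u - v) \<bullet> b))) (at s within {0..1})"
        unfolding has_vector_derivative_def by simp
    qed simp
    then have "integral {0..1} (\<lambda>s. \<Sum>b\<in>Basis. superposition (\<lambda>z. frechet_derivative R (at z) b) (P q) s * ((u - v) \<bullet> b)) = R u - R v"
      by (simp add: integral_unique)
    moreover have "integral {0..1} (\<lambda>s. \<Sum>b\<in>Basis. superposition (\<lambda>z. frechet_derivative R (at z) b) (P q) s * ((u - v) \<bullet> b))
        = (\<Sum>b\<in>Basis. H b q * ((u - v) \<bullet> b))"
      unfolding H_def
      by (subst integral_sum) (auto intro!: integrable_continuous_real continuous_intros)
    ultimately show ?case by (simp add: q)
  qed
  then show ?thesis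
    using Hs by (intro exI[of _ H]) (simp add: case_prod_unfold)
qed

subsection \<open>The integral operator of the flow\<close>

text \<open>A curve on \<open>[0, \<infinity>)\<close> is encoded as a bounded continuous function on all reals that is constant
  for \<open>s \<le> 0\<close>; hence the truncations \<open>max s 0\<close>.\<close>

definition damped_integral :: "real \<Rightarrow> (real \<Rightarrow> real) \<Rightarrow> real \<Rightarrow> real"
  where "damped_integral m \<phi> s = exp (- m * max s 0) * integral {0..max s 0} (\<lambda>r. exp ((m - 1) * r) * \<phi> r)"

lemma damped_integral_integrable:
  "continuous_on UNIV \<phi> \<Longrightarrow> (\<lambda>r. exp ((m - 1) * r) * \<phi> r) integrable_on {a..b::real}"
  by (intro integrable_continuous_real continuous_intros) (auto intro: continuous_on_subset)

lemma damped_integral_max: "damped_integral m \<phi> (max s 0) = damped_integral m \<phi> s"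
  by (simp add: damped_integral_def)

lemma damped_integral_cong: "(\<And>r. r \<ge> 0 \<Longrightarrow> \<phi> r = \<psi> r) \<Longrightarrow> damped_integral m \<phi> s = damped_integral m \<psi> s"
  unfolding damped_integral_def by (intro arg_cong2[where f="(*)"] refl integral_cong) auto

lemma damped_integral_add:
  "continuous_on UNIV \<phi> \<Longrightarrow> continuous_on UNIV \<psi> \<Longrightarrow> damped_integral m (\<lambda>r. \<phi> r + \<psi> r) s = damped_integral m \<phi> s + damped_integral m \<psi> s"
  unfolding damped_integral_def by (simp add: distrib_left integral_add[OF damped_integral_integrable damped_integral_integrable])

lemma damped_integral_scale: "damped_integral m (\<lambda>r. c * \<phi> r) s = c * damped_integral m \<phi> s"
proof -
  have "(\<lambda>r. exp ((m - 1) * r) * (c * \<phi> r)) = (\<lambda>r. c * (exp ((m - 1) * r) * \<phi> r))"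
    by auto
  then show ?thesis unfolding damped_integral_def by simp
qed

text \<open>For s \<ge> 0, \<open>damped_integral m \<phi>\<close> solves y' = - m y + exp (- s)
  \<phi> with y(0) = 0, where exp (- s) is the decay of t along the backward flow. For m \<ge> 0 its
  kernel is at most exp (- r), whose integral is at most 1; hence the bound holds on the whole
  half-line, even for m = 0.\<close>

lemma damped_integral_bound:
  assumes "m \<ge> 0" "continuous_on UNIV \<phi>" "\<And>r. \<bar>\<phi> r\<bar> \<le> C"
  shows "\<bar>damped_integral m \<phi> s\<bar> \<le> C"
proof -
  have C: "C \<ge> 0" using assms(3) by (meson abs_ge_zero order_trans)
  define S where "S = max s 0"
  have S: "S \<ge> 0" by (simp add: S_def)
  have "damped_integral m \<phi> s = integral {0..S} (\<lambda>r. exp (- m * S) * (exp ((m - 1) * r) * \<phi> r))"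
    unfolding damped_integral_def S_def by simp
  also have "norm \<dots> \<le> integral {0..S} (\<lambda>r. C * exp (- r))"
  proof (rule integral_norm_bound_integral)
    show "(\<lambda>r. exp (- m * S) * (exp ((m - 1) * r) * \<phi> r)) integrable_on {0..S}"
      using damped_integral_integrable[OF assms(2)] by (rule integrable_on_mult_right)
    show "(\<lambda>r. C * exp (- r)) integrable_on {0..S}"
      by (intro integrable_continuous_real continuous_intros)
    fix r assume r: "r \<in> {0..S}"
    have "exp (- m * S) * exp ((m - 1) * r) = exp (- m * (S - r)) * exp (- r)"
      by (simp add: exp_add[symmetric] algebra_simps)
    also have "\<dots> \<le> 1 * exp (- r)"
      using r assms(1) by (intro mult_right_mono) auto
    finally have "exp (- m * S) * exp ((m - 1) * r) * \<bar>\<phi> r\<bar> \<le> exp (- r) * C"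
      using assms(3)[of r] by (intro mult_mono) auto
    then show "norm (exp (- m * S) * (exp ((m - 1) * r) * \<phi> r)) \<le> C * exp (- r)"
      by (simp add: abs_mult mult_ac)
  qed
  also have "integral {0..S} (\<lambda>r. C * exp (- r)) = C * (- exp (- S)) - C * (- exp (- 0))"
    by (intro integral_unique fundamental_theorem_of_calculus S)
      (auto intro!: derivative_eq_intros simp: has_real_derivative_iff_has_vector_derivative[symmetric])
  also have "\<dots> \<le> C" using C by simp
  finally show ?thesis by simp
qed

lemma damped_integral_continuous:
  assumes "continuous_on UNIV \<phi>"
  shows "continuous_on UNIV (damped_integral m \<phi>)"
proof -
  define h where "h r = exp ((m - 1) * r) * \<phi> r" for r
  have "isCont (\<lambda>s. integral {0..max s 0} h) s" for s
  proof -
    have "continuous_on {0..\<bar>s\<bar> + 1} (\<lambda>x. integral {0..x} h)"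
      using indefinite_integral_continuous_1[OF damped_integral_integrable[OF assms]] unfolding h_def by blast
    then have "continuous_on {- \<bar>s\<bar> - 1<..<\<bar>s\<bar> + 1} (\<lambda>x. integral {0..max x 0} h)"
      by (rule continuous_on_compose2) (auto intro!: continuous_intros)
    moreover have "s \<in> {- \<bar>s\<bar> - 1<..<\<bar>s\<bar> + 1}"
      by (auto simp: abs_if)
    ultimately show ?thesis
      using continuous_on_eq_continuous_at[OF open_greaterThanLessThan] by blast
  qed
  then have "continuous_on UNIV (\<lambda>s. integral {0..max s 0} h)"
    by (simp add: continuous_at_imp_continuous_on)
  then show ?thesis
    unfolding damped_integral_def h_def by (intro continuous_intros) auto
qed

text \<open>The equation y' = - m y + exp (- s) \<phi> restarted at time s: the first term
  propagates the value reached, and the factor exp (- s) of the second is the decay of t up to then.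
  This is the semigroup law of the flow in integral form.\<close>

lemma damped_integral_shift:
  assumes "continuous_on UNIV \<phi>" "R \<ge> 0" "s \<ge> 0"
  shows "damped_integral m \<phi> (R + s) = exp (- m * R) * damped_integral m \<phi> s + exp (- s) * damped_integral m (\<lambda>u. \<phi> (u + s)) R"
proof -
  define h where "h r = exp ((m - 1) * r) * \<phi> r" for r
  have h: "h integrable_on {a..b}" for a b
    unfolding h_def by (rule damped_integral_integrable[OF assms(1)])
  have ch: "continuous_on UNIV h"
    unfolding h_def by (intro continuous_intros assms)
  have "integral {0..R + s} h = integral {0..s} h + integral {s..R + s} h"
    using Henstock_Kurzweil_Integration.integral_combine[OF assms(3) _ h[of 0 "R + s"]] assms(2) by simp
  also have "integral {s..R + s} h = integral {0..R} (h \<circ> (\<lambda>x. x + s))"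
    using integral_shift[of 0 s R h] continuous_on_subset[OF ch] by simp
  also have "\<dots> = integral {0..R} (\<lambda>x. exp ((m - 1) * s) * (exp ((m - 1) * x) * \<phi> (x + s)))"
    by (simp add: h_def comp_def distrib_left exp_add mult_ac)
  finally have "integral {0..R + s} h = integral {0..s} h + exp ((m - 1) * s) * integral {0..R} (\<lambda>x. exp ((m - 1) * x) * \<phi> (x + s))"
    by simp
  moreover have "exp (- m * (R + s)) * exp ((m - 1) * s) = exp (- s) * exp (- m * R)"
    "exp (- m * (R + s)) = exp (- m * R) * exp (- m * s)"
    by (simp_all add: exp_add[symmetric] algebra_simps)
  ultimately show ?thesis
    unfolding damped_integral_def h_def using assms(2,3) by (simp add: distrib_left mult.assoc[symmetric])
qed

text \<open>The field is read off from an orbit at its starting point. The derivative is one-sided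
  because the curves are truncated at 0.\<close>

lemma damped_integral_derivative_0:
  assumes "continuous_on UNIV \<phi>"
  shows "(damped_integral m \<phi> has_vector_derivative \<phi> 0) (at 0 within {0..})"
proof -
  define h where "h r = exp ((m - 1) * r) * \<phi> r" for r
  have "continuous_on {0..1} h"
    unfolding h_def by (intro continuous_intros continuous_on_subset[OF assms]) auto
  then have "((\<lambda>x. integral {0..x} h) has_real_derivative h 0) (at 0 within {0..1})"
    by (rule integral_has_real_derivative) simp
  then have "((\<lambda>x. integral {0..x} h) has_real_derivative \<phi> 0) (at 0 within {0..})"
    by (simp add: h_def at_within_Icc_at_right at_within_Ici_at_right[symmetric])
  then have "((\<lambda>x. exp (- m * x) * integral {0..x} h) has_real_derivative \<phi> 0) (at 0 within {0..})"
    by (auto intro!: derivative_eq_intros)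
  then have "(damped_integral m \<phi> has_real_derivative \<phi> 0) (at 0 within {0..})"
    by (rule has_field_derivative_transform_within[where d = 1]) (auto simp: damped_integral_def h_def[abs_def])
  then show ?thesis by (simp add: has_real_derivative_iff_has_vector_derivative)
qed

text \<open>For s \<ge> 0 this is the flow of the linear part of - \<open>V\<close>, with
  eigenvalues - 1, 0 and - \<open>n\<close>.\<close>

definition flow_base :: "nat \<Rightarrow> real \<times> real \<times> real \<Rightarrow> real \<Rightarrow>\<^sub>C (real \<times> real \<times> real)"
  where "flow_base n q = Bcontfun (\<lambda>s. (exp (- max s 0) * fst q, fst (snd q), exp (- real n * max s 0) * snd (snd q)))"

text \<open>Variation of constants for the terms t f and t g, where t is replaced by exp (- s) times
  its initial value and that value is taken out as a factor. The first component is 0 because the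
  equation of t is exactly linear; the rate is 0 for x and \<open>n\<close> for P.\<close>

definition flow_kernel :: "nat \<Rightarrow> (real \<Rightarrow>\<^sub>C (real \<times> real \<times> real)) \<Rightarrow> real \<Rightarrow>\<^sub>C (real \<times> real \<times> real)"
  where "flow_kernel n G = Bcontfun (\<lambda>s. (0, damped_integral 0 (\<lambda>r. fst (snd (G r))) s, damped_integral (real n) (\<lambda>r. snd (snd (G r))) s))"

lemma norm_triple_le: "norm (a::real, b::real, c::real) \<le> \<bar>a\<bar> + \<bar>b\<bar> + \<bar>c\<bar>"
  using norm_Pair_le[of a "(b, c)"] norm_Pair_le[of b c] by simp

lemma norm_triple_ge: "\<bar>fst q\<bar> \<le> norm q" "\<bar>fst (snd q)\<bar> \<le> norm q" "\<bar>snd (snd q)\<bar> \<le> norm q"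
  for q :: "real \<times> real \<times> real"
  by (cases q; metis norm_fst_le norm_snd_le order_trans real_norm_def fst_conv snd_conv prod.collapse)+

lemma
  shows apply_flow_base: "apply_bcontfun (flow_base n q) s =
      (exp (- max s 0) * fst q, fst (snd q), exp (- real n * max s 0) * snd (snd q))"
    and norm_flow_base: "norm (flow_base n q) \<le> norm q * 3"
proof -
  let ?f = "\<lambda>s. (exp (- max s 0) * fst q, fst (snd q), exp (- real n * max s 0) * snd (snd q))"
  have *: "norm (?f s) \<le> norm q * 3" for s
  proof -
    have "exp (- max s 0) * \<bar>fst q\<bar> \<le> 1 * norm q" "exp (- real n * max s 0) * \<bar>snd (snd q)\<bar> \<le> 1 * norm q"
      using norm_triple_ge[of q] by (intro mult_mono; simp)+
    then show ?thesis
      using norm_triple_le[of "exp (- max s 0) * fst q" "fst (snd q)" "exp (- real n * max s 0) * snd (snd q)"]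
        norm_triple_ge(2)[of q] by (simp add: abs_mult)
  qed
  have "?f \<in> bcontfun"
    by (rule bcontfun_normI[OF _ *]) (intro continuous_intros)
  then show **: "apply_bcontfun (flow_base n q) s = ?f s" for s
    unfolding flow_base_def by (simp add: Bcontfun_inverse)
  show "norm (flow_base n q) \<le> norm q * 3"
    by (rule norm_bound) (simp only: ** *)
qed

lemma bounded_linear_flow_base: "bounded_linear (flow_base n)"
  by (rule bounded_linear_intro[OF _ _ norm_flow_base])
    (auto intro!: bcontfun_eqI simp: apply_flow_base algebra_simps)

lemma
  shows apply_flow_kernel: "apply_bcontfun (flow_kernel n G) s =
      (0, damped_integral 0 (\<lambda>r. fst (snd (G r))) s, damped_integral (real n) (\<lambda>r. snd (snd (G r))) s)"
    and norm_flow_kernel: "norm (flow_kernel n G) \<le> norm G * 2"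
proof -
  let ?f = "\<lambda>s. (0::real, damped_integral 0 (\<lambda>r. fst (snd (G r))) s, damped_integral (real n) (\<lambda>r. snd (snd (G r))) s)"
  have c: "continuous_on UNIV (\<lambda>r. fst (snd (G r)))" "continuous_on UNIV (\<lambda>r. snd (snd (G r)))"
    by (intro continuous_intros; simp)+
  have *: "norm (?f s) \<le> norm G * 2" for s
  proof -
    have "\<bar>damped_integral 0 (\<lambda>r. fst (snd (G r))) s\<bar> \<le> norm G" "\<bar>damped_integral (real n) (\<lambda>r. snd (snd (G r))) s\<bar> \<le> norm G"
      using norm_triple_ge(2,3)[of "G _"] norm_bounded[of G]
      by (intro damped_integral_bound c; meson order_trans of_nat_0_le_iff order_refl)+
    then show ?thesis
      using norm_triple_le[of 0 "damped_integral 0 (\<lambda>r. fst (snd (G r))) s" "damped_integral (real n) (\<lambda>r. snd (snd (G r))) s"] by simp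
  qed
  have "?f \<in> bcontfun"
    by (rule bcontfun_normI[OF _ *]) (intro continuous_intros damped_integral_continuous c)
  then show **: "apply_bcontfun (flow_kernel n G) s = ?f s" for s
    unfolding flow_kernel_def by (simp add: Bcontfun_inverse)
  show "norm (flow_kernel n G) \<le> norm G * 2"
    by (rule norm_bound) (simp only: ** *)
qed

lemma bounded_linear_flow_kernel: "bounded_linear (flow_kernel n)"
proof (rule bounded_linear_intro[OF _ _ norm_flow_kernel])
  have c: "continuous_on UNIV (\<lambda>r. fst (snd (apply_bcontfun G r)))" "continuous_on UNIV (\<lambda>r. snd (snd (apply_bcontfun G r)))"
    for G :: "real \<Rightarrow>\<^sub>C (real \<times> real \<times> real)"
    by (intro continuous_intros; simp)+
  show "flow_kernel n (G + H) = flow_kernel n G + flow_kernel n H" for G H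
    by (intro bcontfun_eqI) (simp add: apply_flow_kernel damped_integral_add c)
  show "flow_kernel n (r *\<^sub>R G) = r *\<^sub>R flow_kernel n G" for r G
    by (intro bcontfun_eqI) (simp add: apply_flow_kernel damped_integral_scale)
qed

subsection \<open>The backward flow\<close>

locale resonant_field =
  fixes n :: nat and x\<^sub>0 :: real and f g :: "real \<times> real \<times> real \<Rightarrow> real"
  assumes n: "n \<ge> 1"
    and f: "smooth_near (0, x\<^sub>0, 0) f"
    and g: "smooth_near (0, x\<^sub>0, 0) g"
begin

abbreviation "a\<^sub>0 \<equiv> (0, x\<^sub>0, 0) :: real \<times> real \<times> real"

definition V :: "real \<times> real \<times> real \<Rightarrow> real \<times> real \<times> real"
  where "V q = (fst q, fst q * f q, real n * snd (snd q) + fst q * g q)"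

text \<open>Orbits are constructed for starting points in \<open>S\<close> only, so the semigroup
  law is claimed while the orbit is in \<open>S\<close>. It follows from uniqueness of the fixed
  point: a shifted orbit solves the equation of its own starting point.\<close>

lemma flow_exists:
  obtains w S where "open S" "a\<^sub>0 \<in> S" "smooth_on S w" "w a\<^sub>0 = const_bcontfun a\<^sub>0"
    "\<And>q. q \<in> S \<Longrightarrow> apply_bcontfun (w q) 0 = q"
    "\<And>q s u. q \<in> S \<Longrightarrow> s \<ge> 0 \<Longrightarrow> apply_bcontfun (w q) s \<in> S \<Longrightarrow> u \<ge> 0 \<Longrightarrow>
       apply_bcontfun (w (apply_bcontfun (w q) s)) u = apply_bcontfun (w q) (u + s)"
    "\<And>q. q \<in> S \<Longrightarrow> (apply_bcontfun (w q) has_vector_derivative - V q) (at 0 within {0..})"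
proof -
  define N where "N q = (0 :: real, f q, g q)" for q
  have "smooth_near a\<^sub>0 N"
    unfolding N_def by (intro smooth_near_intros f g)
  then obtain T where T: "open T" "a\<^sub>0 \<in> T" "smooth_on T N" unfolding smooth_near_def by blast
  obtain R where R: "R > 0" "cball a\<^sub>0 R \<subseteq> T" using T open_contains_cball by blast
  \<comment> \<open>Curves are kept in the ball of radius \<open>r\<close>; the gap up to
    \<open>R\<close> is the margin for differentiating superpositions.\<close>
  define r where "r = R / 2"
  have r: "r > 0" "r < R" using R by (auto simp: r_def)
  have sub: "cball a\<^sub>0 r \<subseteq> cball a\<^sub>0 R" using r by auto
  let ?D = "\<lambda>b z. frechet_derivative N (at z) b"
  have cN: "continuous_on (cball a\<^sub>0 R) N"
    by (rule continuous_on_subset[OF Ck_on_continuous[OF smooth_onD[OF T(3)]] R(2)])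
  have cD: "continuous_on (cball a\<^sub>0 R) (?D b)" for b
    by (rule continuous_on_subset[OF Ck_on_continuous[OF smooth_onD[OF smooth_on_frechet[OF T(3)]]] R(2)])
  have "\<exists>B>0. \<forall>z\<in>cball a\<^sub>0 R. norm (h z) \<le> B" if "continuous_on (cball a\<^sub>0 R) h"
    for h :: "real \<times> real \<times> real \<Rightarrow> real \<times> real \<times> real"
    using compact_imp_bounded[OF compact_continuous_image[OF that compact_cball]]
    unfolding bounded_pos by auto
  then have "\<exists>B>0. \<forall>z\<in>cball a\<^sub>0 R. norm (N z) \<le> B" "\<forall>b. \<exists>B>0. \<forall>z\<in>cball a\<^sub>0 R. norm (?D b z) \<le> B"
    using cN cD by auto
  then obtain N0 B where N0: "N0 > 0" "\<And>z. z \<in> cball a\<^sub>0 R \<Longrightarrow> norm (N z) \<le> N0"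
    and B: "\<And>b. B b > 0" "\<And>b z. z \<in> cball a\<^sub>0 R \<Longrightarrow> norm (?D b z) \<le> B b"
    by metis
  define M where "M = (\<Sum>b\<in>Basis. B b)"
  have M: "M \<ge> 0" unfolding M_def using B(1) by (intro sum_nonneg) (simp add: less_imp_le)
  \<comment> \<open>\<open>3\<close> and \<open>2\<close> are the norm bounds of
    \<open>flow_base\<close> and \<open>flow_kernel\<close>. The first entry yields the contraction
    constant 1 / 2, with \<open>M + 1\<close> guarding against M = 0; by the second, the constant
    curve is moved by at most r / 2.\<close>
  define \<delta> where "\<delta> = min (1 / (4 * (M + 1))) (r / (2 * (3 + 2 * N0)))"
  have \<delta>: "\<delta> > 0" "\<delta> * (2 * M) \<le> 1 / 2" "\<delta> * (3 + 2 * N0) \<le> r / 2"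
  proof -
    show "\<delta> > 0" using M r N0(1) by (simp add: \<delta>_def)
    have "\<delta> * (2 * M) \<le> 1 / (4 * (M + 1)) * (2 * M)"
      using M by (intro mult_right_mono) (auto simp: \<delta>_def)
    also have "\<dots> \<le> 1 / 2" using M by (simp add: field_simps)
    finally show "\<delta> * (2 * M) \<le> 1 / 2" .
    have "\<delta> * (3 + 2 * N0) \<le> r / (2 * (3 + 2 * N0)) * (3 + 2 * N0)"
      using N0(1) by (intro mult_right_mono) (auto simp: \<delta>_def)
    also have "\<dots> = r / 2" using N0(1) by (simp add: field_simps)
    finally show "\<delta> * (3 + 2 * N0) \<le> r / 2" .
  qed
  have Nlip: "norm (N u - N v) \<le> M * norm (u - v)" if "u \<in> cball a\<^sub>0 R" "v \<in> cball a\<^sub>0 R" for u v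
  proof (rule differentiable_bound[OF convex_cball _ _ that])
    fix z assume z: "z \<in> cball a\<^sub>0 R"
    have d: "(N has_derivative frechet_derivative N (at z)) (at z)"
      using smooth_on_has_derivative[OF T(3)] z R(2) by blast
    then show "(N has_derivative frechet_derivative N (at z)) (at z within cball a\<^sub>0 R)"
      using has_derivative_at_withinI by blast
    show "onorm (frechet_derivative N (at z)) \<le> M"
    proof (rule onorm_le)
      fix h
      have "norm (frechet_derivative N (at z) h) \<le> (\<Sum>b\<in>Basis. norm h * B b)"
      proof (subst linear_euclidean_sum[OF has_derivative_linear[OF d]], rule sum_norm_le)
        fix b :: "real \<times> real \<times> real" assume b: "b \<in> Basis"
        show "norm ((h \<bullet> b) *\<^sub>R ?D b z) \<le> norm h * B b"
          unfolding norm_scaleR using Basis_le_norm[OF b, of h] B(1)[of b] B(2)[OF z, of b]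
          by (intro mult_mono) auto
      qed
      then show "norm (frechet_derivative N (at z) h) \<le> M * norm h"
        by (simp add: M_def sum_distrib_left mult.commute)
    qed
  qed
  have rng: "range (apply_bcontfun y) \<subseteq> cball a\<^sub>0 r" if "y \<in> cball (const_bcontfun a\<^sub>0) r" for y :: "real \<Rightarrow>\<^sub>C (real \<times> real \<times> real)"
  proof -
    have "dist a\<^sub>0 (y s) \<le> r" for s
      using dist_bounded[of "const_bcontfun a\<^sub>0" s y] that by simp
    then show ?thesis by auto
  qed
  have rngR: "range (apply_bcontfun y) \<subseteq> cball a\<^sub>0 R" if "y \<in> cball (const_bcontfun a\<^sub>0) r" for y :: "real \<Rightarrow>\<^sub>C (real \<times> real \<times> real)"
    using order_trans[OF rng[OF that] sub] .
  have nN: "apply_bcontfun (superposition N y) s = N (y s)" if "y \<in> cball (const_bcontfun a\<^sub>0) r"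
    for y :: "real \<Rightarrow>\<^sub>C (real \<times> real \<times> real)" and s
    using apply_superposition[OF compact_cball cN rngR[OF that]] .
  \<comment> \<open>The minus sign is that of the backward flow. The factor \<open>fst q\<close>,
    the initial value of t, is what makes this a contraction in \<open>y\<close>.\<close>
  define \<Phi> where "\<Phi> = (\<lambda>(q :: real \<times> real \<times> real, y). flow_base n q - fst q *\<^sub>R flow_kernel n (superposition N y))"
  define S where "S = ball a\<^sub>0 \<delta>"
  have Sf: "\<bar>fst q\<bar> \<le> \<delta>" if "q \<in> S" for q
    using that norm_triple_ge(1)[of "q - a\<^sub>0"] by (simp add: S_def dist_norm norm_minus_commute)
  have Kbound: "\<bar>fst q\<bar> * (norm G * 2) \<le> 1 / 2 * c" if "q \<in> S" "norm G \<le> M * c" "c \<ge> 0" for q c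
    and G :: "real \<Rightarrow>\<^sub>C (real \<times> real \<times> real)"
  proof -
    have "\<bar>fst q\<bar> * (norm G * 2) \<le> \<delta> * (M * c * 2)"
      using Sf[OF that(1)] that(2,3) M \<delta>(1) by (intro mult_mono) auto
    also have "\<dots> = \<delta> * (2 * M) * c" by simp
    also have "\<dots> \<le> 1 / 2 * c" using \<delta>(2) that(3) by (rule mult_right_mono)
    finally show ?thesis .
  qed
  obtain w where w: "\<And>q. q \<in> S \<Longrightarrow> w q \<in> cball (const_bcontfun a\<^sub>0) r" "\<And>q. q \<in> S \<Longrightarrow> \<Phi> (q, w q) = w q"
    "\<And>q z. q \<in> S \<Longrightarrow> z \<in> cball (const_bcontfun a\<^sub>0) r \<Longrightarrow> \<Phi> (q, z) = z \<Longrightarrow> z = w q"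
    "continuous_on S w"
  proof (rule param_contraction[of r "1 / 2" S "const_bcontfun a\<^sub>0" "\<lambda>q y. \<Phi> (q, y)"])
    fix q and y y' :: "real \<Rightarrow>\<^sub>C (real \<times> real \<times> real)" assume q: "q \<in> S" and y: "y \<in> cball (const_bcontfun a\<^sub>0) r" "y' \<in> cball (const_bcontfun a\<^sub>0) r"
    have *: "norm (superposition N y' - superposition N y) \<le> M * norm (y' - y)"
    proof (rule norm_bound)
      fix s
      have "norm (N (y' s) - N (y s)) \<le> M * norm (y' s - y s)"
        using rngR[OF y(1)] rngR[OF y(2)] by (intro Nlip) blast+
      also have "\<dots> \<le> M * norm (y' - y)"
        using norm_bounded[of "y' - y" s] M by (intro mult_left_mono) auto
      finally show "norm (apply_bcontfun (superposition N y' - superposition N y) s) \<le> M * norm (y' - y)"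
        by (simp add: nN[OF y(1)] nN[OF y(2)])
    qed
    have "\<Phi> (q, y) - \<Phi> (q, y') = fst q *\<^sub>R flow_kernel n (superposition N y' - superposition N y)"
      by (simp add: \<Phi>_def linear_diff[OF bounded_linear.linear[OF bounded_linear_flow_kernel]] algebra_simps)
    also have "norm \<dots> \<le> \<bar>fst q\<bar> * (norm (superposition N y' - superposition N y) * 2)"
      unfolding norm_scaleR by (intro mult_left_mono norm_flow_kernel) auto
    also have "\<dots> \<le> 1 / 2 * norm (y' - y)"
      by (rule Kbound[OF q *]) simp
    finally show "dist (\<Phi> (q, y)) (\<Phi> (q, y')) \<le> 1 / 2 * dist y y'"
      by (simp add: dist_norm norm_minus_commute)
  next
    fix q assume q: "q \<in> S"
    have base: "flow_base n a\<^sub>0 = const_bcontfun a\<^sub>0"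
      by (rule bcontfun_eqI) (simp add: apply_flow_base)
    have c: "const_bcontfun a\<^sub>0 \<in> cball (const_bcontfun a\<^sub>0 :: real \<Rightarrow>\<^sub>C _) r" using r by simp
    have "norm (superposition N (const_bcontfun a\<^sub>0 :: real \<Rightarrow>\<^sub>C _)) \<le> N0"
      by (rule norm_bound) (use N0(2) R nN[OF c] in auto)
    then have "norm (fst q *\<^sub>R flow_kernel n (superposition N (const_bcontfun a\<^sub>0))) \<le> \<delta> * (N0 * 2)"
      unfolding norm_scaleR using Sf[OF q] \<delta>(1) N0(1) by (intro mult_mono order_trans[OF norm_flow_kernel]) auto
    moreover have "norm (flow_base n (q - a\<^sub>0)) \<le> \<delta> * 3"
      using q by (intro order_trans[OF norm_flow_base]) (simp add: S_def dist_norm norm_minus_commute)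
    ultimately have "norm (flow_base n (q - a\<^sub>0) - fst q *\<^sub>R flow_kernel n (superposition N (const_bcontfun a\<^sub>0))) \<le> \<delta> * 3 + \<delta> * (N0 * 2)"
      using norm_triangle_ineq4[of "flow_base n (q - a\<^sub>0)" "fst q *\<^sub>R flow_kernel n (superposition N (const_bcontfun a\<^sub>0))"] by linarith
    moreover have "\<Phi> (q, const_bcontfun a\<^sub>0) - const_bcontfun a\<^sub>0
        = flow_base n (q - a\<^sub>0) - fst q *\<^sub>R flow_kernel n (superposition N (const_bcontfun a\<^sub>0))"
      unfolding \<Phi>_def linear_diff[OF bounded_linear.linear[OF bounded_linear_flow_base]] base by simp
    ultimately have "norm (\<Phi> (q, const_bcontfun a\<^sub>0) - const_bcontfun a\<^sub>0) \<le> \<delta> * 3 + \<delta> * (N0 * 2)"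
      by (simp only:)
    also have "\<dots> \<le> (1 - 1 / 2) * r" using \<delta>(3) by (simp add: algebra_simps)
    finally show "dist (\<Phi> (q, const_bcontfun a\<^sub>0)) (const_bcontfun a\<^sub>0) \<le> (1 - 1 / 2) * r"
      by (simp add: dist_norm)
  next
    fix y :: "real \<Rightarrow>\<^sub>C (real \<times> real \<times> real)" assume "y \<in> cball (const_bcontfun a\<^sub>0) r"
    show "continuous_on S (\<lambda>q. \<Phi> (q, y))"
      unfolding \<Phi>_def using bounded_linear.continuous_on[OF bounded_linear_flow_base continuous_on_id]
      by (auto intro!: continuous_intros)
  qed (use r in auto)
  have oS: "open S" and aS: "a\<^sub>0 \<in> S" using \<delta>(1) by (auto simp: S_def)
  define Kb where "Kb = Blinfun (flow_kernel n)"
  have Kb: "blinfun_apply Kb = flow_kernel n"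
    unfolding Kb_def by (rule bounded_linear_Blinfun_apply[OF bounded_linear_flow_kernel])
  \<comment> \<open>\<open>pr b G\<close> is \<open>inner_scale b G\<close> as a bounded operator
    and depends linearly on \<open>G\<close>; thus smoothness of \<open>L\<close> below reduces to
    that of superpositions.\<close>
  define pr where "pr b = bounded_bilinear.prod_right (inner_scale b :: (real \<Rightarrow>\<^sub>C (real \<times> real \<times> real)) \<Rightarrow> (real \<Rightarrow>\<^sub>C (real \<times> real \<times> real)) \<Rightarrow> _)" for b
  have pr: "blinfun_apply (pr b G) = inner_scale b G" "bounded_linear (pr b)" for b G
    unfolding pr_def by (rule bounded_bilinear.prod_right.rep_eq[OF bounded_bilinear_inner_scale],
        rule bounded_bilinear.bounded_linear_prod_right[OF bounded_bilinear_inner_scale])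
  \<comment> \<open>\<open>L q\<close> and \<open>BB q\<close> are the partial derivatives of
    \<open>\<Phi>\<close> at (q, w q), with respect to the curve and to \<open>q\<close>.\<close>
  define L where "L q = (\<Sum>b\<in>Basis. (- fst q) *\<^sub>R (Kb o\<^sub>L pr b (superposition (?D b) (w q))))" for q
  define BB where "BB q v = flow_base n v - fst v *\<^sub>R flow_kernel n (superposition N (w q))" for q v
  have Lapp: "L q h = - (fst q *\<^sub>R flow_kernel n (\<Sum>b\<in>Basis. inner_scale b (superposition (?D b) (w q)) h))" for q h
    unfolding L_def
    by (simp add: blinfun.sum_left blinfun.scaleR_left blinfun.minus_left Kb pr
        linear_sum[OF bounded_linear.linear[OF bounded_linear_flow_kernel]] scaleR_sum_right sum_negf)
  have rngw: "range (apply_bcontfun (w q)) \<subseteq> cball a\<^sub>0 r" if "q \<in> S" for q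
    using rng w(1) that by blast
  have sm: "smooth_on S w"
  proof (rule smooth_on_fixpoint[OF oS w(4), where \<kappa> = "1 / 2" and L = L and \<Phi> = \<Phi> and B = BB])
    fix q assume q: "q \<in> S"
    show "norm (L q) \<le> 1 / 2"
    proof (rule norm_blinfun_bound)
      fix h
      have "norm (\<Sum>b\<in>Basis. inner_scale b (superposition (?D b) (w q)) h) \<le> (\<Sum>b\<in>Basis. B b * norm h)"
      proof (rule sum_norm_le)
        fix b :: "real \<times> real \<times> real" assume b: "b \<in> Basis"
        have "norm (superposition (?D b) (w q)) \<le> B b"
        proof (rule norm_bound)
          fix s
          show "norm (superposition (?D b) (w q) s) \<le> B b"
            unfolding apply_superposition[OF compact_cball cD rngR[OF w(1)[OF q]]]
            using rngR[OF w(1)[OF q]] by (intro B(2)) blast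
        qed
        then have "norm (superposition (?D b) (w q)) * norm h * norm b \<le> B b * norm h"
          using b by (simp add: mult_right_mono)
        then show "norm (inner_scale b (superposition (?D b) (w q)) h) \<le> B b * norm h"
          by (rule order_trans[OF norm_inner_scale_le])
      qed
      then have *: "norm (\<Sum>b\<in>Basis. inner_scale b (superposition (?D b) (w q)) h) \<le> M * norm h"
        by (simp add: M_def sum_distrib_right)
      have "norm (L q h) \<le> \<bar>fst q\<bar> * (norm (\<Sum>b\<in>Basis. inner_scale b (superposition (?D b) (w q)) h) * 2)"
        unfolding Lapp norm_minus_cancel norm_scaleR by (intro mult_left_mono norm_flow_kernel) auto
      also have "\<dots> \<le> 1 / 2 * norm h" by (rule Kbound[OF q *]) simp
      finally show "norm (L q h) \<le> 1 / 2 * norm h" .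
    qed simp
    have nd: "((\<lambda>p. superposition N (snd p)) has_derivative (\<lambda>p. \<Sum>b\<in>Basis. inner_scale b (superposition (?D b) (w q)) (snd p))) (at (q, w q))"
      using has_derivative_compose[OF bounded_linear_imp_has_derivative[OF bounded_linear_snd], of "superposition N" _ "(q, w q)"]
        superposition_has_derivative[OF smooth_onD[OF T(3)] r(2) R(2) rngw[OF q]] by simp
    have "(\<Phi> has_derivative (\<lambda>p. flow_base n (fst p) - (fst q *\<^sub>R flow_kernel n (\<Sum>b\<in>Basis. inner_scale b (superposition (?D b) (w q)) (snd p))
        + fst (fst p) *\<^sub>R flow_kernel n (superposition N (w q))))) (at (q, w q))"
      unfolding \<Phi>_def case_prod_beta
      by (rule derivative_eq_intros bounded_linear.has_derivative[OF bounded_linear_flow_base]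
          bounded_linear.has_derivative[OF bounded_linear_flow_kernel] nd refl | simp)+
    then show "(\<Phi> has_derivative (\<lambda>(v, h). L q h + BB q v)) (at (q, w q))"
      by (rule has_derivative_eq_rhs) (auto simp: Lapp BB_def fun_eq_iff)
  next
    fix q assume "q \<in> S" then show "w q = \<Phi> (q, w q)" using w(2) by simp
  next
    fix k assume k: "Ck_on k S w"
    have fs: "Ck_on k S (\<lambda>q. - fst q)"
      by (rule Ck_on_bounded_linear_comp[OF bounded_linear_minus[OF bounded_linear_fst] oS Ck_on_ident[OF oS]])
    show "Ck_on k S L"
      unfolding L_def
      by (intro Ck_on_sum oS Ck_on_bounded_bilinear[OF bounded_bilinear_scaleR] fs
          Ck_on_bounded_linear_comp[OF bounded_bilinear.bounded_linear_right[OF bounded_bilinear_blinfun_compose]]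
          Ck_on_bounded_linear_comp[OF pr(2)]
          Ck_on_superposition[OF oS T(1) k smooth_onD[OF smooth_on_frechet[OF T(3)]] r(2) R(2) rngw])
    show "Ck_on k S (\<lambda>q. BB q v)" for v
    proof -
      have "Ck_on k S (\<lambda>q. flow_base n v + (- fst v) *\<^sub>R flow_kernel n (superposition N (w q)))"
        by (intro Ck_on_add oS Ck_on_const Ck_on_bounded_linear_comp[OF bounded_linear_scaleR_right]
            Ck_on_bounded_linear_comp[OF bounded_linear_flow_kernel]
            Ck_on_superposition[OF oS T(1) k smooth_onD[OF T(3)] r(2) R(2) rngw])
      then show ?thesis by (simp add: BB_def)
    qed
  qed simp
  have wapp: "apply_bcontfun (w q) s = (exp (- max s 0) * fst q, fst (snd q) - fst q * damped_integral 0 (\<lambda>r. f (w q r)) s,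
      exp (- real n * max s 0) * snd (snd q) - fst q * damped_integral (real n) (\<lambda>r. g (w q r)) s)" if q: "q \<in> S" for q s
  proof -
    have "apply_bcontfun (w q) s = apply_bcontfun (\<Phi> (q, w q)) s" using w(2)[OF q] by simp
    also have "\<dots> = (exp (- max s 0) * fst q, fst (snd q) - fst q * damped_integral 0 (\<lambda>r. f (w q r)) s,
      exp (- real n * max s 0) * snd (snd q) - fst q * damped_integral (real n) (\<lambda>r. g (w q r)) s)"
      by (simp add: \<Phi>_def apply_flow_base apply_flow_kernel nN[OF w(1)[OF q]] N_def)
    finally show ?thesis .
  qed
  have cont: "continuous_on UNIV (\<lambda>r. f (w q r))" "continuous_on UNIV (\<lambda>r. g (w q r))" if q: "q \<in> S" for q
  proof -
    have "continuous_on UNIV (\<lambda>s. N (w q s))"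
      using continuous_on_compose2[OF cN continuous_on_apply_bcontfun rngR[OF w(1)[OF q]]] .
    from continuous_on_fst[OF continuous_on_snd[OF this]] continuous_on_snd[OF continuous_on_snd[OF this]]
    show "continuous_on UNIV (\<lambda>r. f (w q r))" "continuous_on UNIV (\<lambda>r. g (w q r))"
      by (simp_all add: N_def)
  qed
  have w0: "apply_bcontfun (w q) 0 = q" if q: "q \<in> S" for q
    by (subst wapp[OF q]) (simp add: damped_integral_def)
  have wa: "w a\<^sub>0 = const_bcontfun a\<^sub>0"
    by (rule bcontfun_eqI, subst wapp[OF aS]) simp
  have semi: "apply_bcontfun (w (apply_bcontfun (w q) s)) u = apply_bcontfun (w q) (u + s)"
    if q: "q \<in> S" and s: "s \<ge> 0" and p: "apply_bcontfun (w q) s \<in> S" and u: "u \<ge> 0" for q s u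
  proof -
    \<comment> \<open>The orbit of \<open>q\<close> from time \<open>s\<close> on, made constant for
      negative times as all solutions \<open>w q\<close> are.\<close>
    define y where "y = Bcontfun (\<lambda>u. apply_bcontfun (w q) (max u 0 + s))"
    have "(\<lambda>u. apply_bcontfun (w q) (max u 0 + s)) \<in> bcontfun"
      by (rule bcontfun_normI[where b = "norm (w q)"])
        (auto intro!: norm_bounded continuous_intros continuous_on_compose2[OF continuous_on_apply_bcontfun[of UNIV]])
    then have y: "apply_bcontfun y u = apply_bcontfun (w q) (max u 0 + s)" for u
      unfolding y_def by (simp add: Bcontfun_inverse)
    have yc: "y \<in> cball (const_bcontfun a\<^sub>0) r"
      using rngw[OF q] unfolding mem_cball image_subset_iff by (intro dist_bound) (simp add: y)
    have "\<Phi> (w q s, y) = y"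
    proof (rule bcontfun_eqI)
      fix u :: real
      define U where "U = max u 0"
      have U: "U \<ge> 0" by (simp add: U_def)
      have k: "damped_integral m (\<lambda>r. \<phi> (y r)) u = damped_integral m (\<lambda>r. \<phi> (w q (r + s))) U" for m \<phi>
        unfolding U_def damped_integral_max by (rule damped_integral_cong) (simp add: y)
      show "apply_bcontfun (\<Phi> (w q s, y)) u = apply_bcontfun y u"
        unfolding y U_def[symmetric]
        using U s
        by (simp add: \<Phi>_def apply_flow_base apply_flow_kernel nN[OF yc] N_def k wapp[OF q, of s]
           wapp[OF q, of "U + s"] damped_integral_shift[OF cont(1)[OF q] U s] damped_integral_shift[OF cont(2)[OF q] U s] exp_add
           U_def[symmetric] algebra_simps, simp add: exp_add[symmetric])
    qed
    from w(3)[OF p yc this] have "w (w q s) = y" by simp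
    then show ?thesis using y u by simp
  qed
  have der: "(apply_bcontfun (w q) has_vector_derivative - V q) (at 0 within {0..})" if q: "q \<in> S" for q
  proof -
    have e: "((\<lambda>s. exp (- m * s) * c) has_vector_derivative - m * c) (at 0 within {0..})" for m c :: real
      unfolding has_real_derivative_iff_has_vector_derivative[symmetric] by (auto intro!: derivative_eq_intros)
    have "((\<lambda>s. (exp (- 1 * s) * fst q, fst (snd q) - fst q * damped_integral 0 (\<lambda>r. f (w q r)) s,
        exp (- real n * s) * snd (snd q) - fst q * damped_integral (real n) (\<lambda>r. g (w q r)) s))
      has_vector_derivative (- 1 * fst q, 0 - fst q * f (w q 0), - real n * snd (snd q) - fst q * g (w q 0))) (at 0 within {0..})"
      by (intro has_vector_derivative_Pair has_vector_derivative_diff e has_vector_derivative_const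
          has_vector_derivative_mult_right damped_integral_derivative_0 cont q)
    then have "((\<lambda>s. (exp (- 1 * s) * fst q, fst (snd q) - fst q * damped_integral 0 (\<lambda>r. f (w q r)) s,
        exp (- real n * s) * snd (snd q) - fst q * damped_integral (real n) (\<lambda>r. g (w q r)) s))
      has_vector_derivative - V q) (at 0 within {0..})"
      by (simp add: V_def w0[OF q])
    then show ?thesis
    proof (rule has_vector_derivative_transform_within[where d = 1])
      fix s :: real assume "s \<in> {0..}"
      then show "(exp (- 1 * s) * fst q, fst (snd q) - fst q * damped_integral 0 (\<lambda>r. f (w q r)) s,
        exp (- real n * s) * snd (snd q) - fst q * damped_integral (real n) (\<lambda>r. g (w q r)) s) = apply_bcontfun (w q) s"
        by (subst wapp[OF q]) simp
    qed auto
  qed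
  show thesis
    using that[OF oS aS sm wa w0 semi der] by blast
qed

end

subsection \<open>The Laplace transform along the flow\<close>

lemma laplace_integrable:
  fixes \<phi> :: "real \<Rightarrow> real"
  assumes "k > 0" "continuous_on UNIV \<phi>" "\<And>u. \<bar>\<phi> u\<bar> \<le> C"
  shows "(\<lambda>u. exp (- k * u) * \<phi> u) absolutely_integrable_on {c..}"
proof (rule measurable_bounded_by_integrable_imp_absolutely_integrable)
  show "(\<lambda>u. exp (- k * u) * \<phi> u) \<in> borel_measurable (lebesgue_on {c..})"
    by (intro continuous_imp_measurable_on_sets_lebesgue continuous_intros continuous_on_subset[OF assms(2)]) auto
  show "(\<lambda>u. C * exp (- k * u)) integrable_on {c..}"
    using has_integral_exp_minus_to_infinity[OF assms(1), of c]
    by (intro integrable_on_mult_right) (auto simp: integrable_on_def)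
  show "norm (exp (- k * u) * \<phi> u) \<le> C * exp (- k * u)" for u
    using mult_right_mono[OF assms(3)[of u], of "exp (- k * u)"] by (simp add: abs_mult mult.commute)
qed auto

lemma integral_atLeast_shift:
  fixes h :: "real \<Rightarrow> real"
  assumes "h absolutely_integrable_on {s..}" "(\<lambda>u. h (u + s)) absolutely_integrable_on {0..}"
  shows "integral {0..} (\<lambda>u. h (u + s)) = integral {s..} h"
proof -
  have "integral {s..} h = (\<integral>x. indicat_real {s..} x *\<^sub>R h x \<partial>lebesgue)"
    using set_lebesgue_integral_eq_integral(2)[OF assms(1)] by (simp add: set_lebesgue_integral_def)
  also have "\<dots> = (\<integral>x. indicat_real {s..} (s + x) *\<^sub>R h (s + x) \<partial>lebesgue)"
    using lebesgue_integral_real_affine[of 1 "\<lambda>x. indicat_real {s..} x *\<^sub>R h x" s] by simp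
  also have "(\<lambda>x. indicat_real {s..} (s + x) *\<^sub>R h (s + x)) = (\<lambda>x. indicat_real {0..} x *\<^sub>R h (x + s))"
    by (auto simp: indicator_def add.commute)
  also have "(\<integral>x. indicat_real {0..} x *\<^sub>R h (x + s) \<partial>lebesgue) = integral {0..} (\<lambda>u. h (u + s))"
    using set_lebesgue_integral_eq_integral(2)[OF assms(2)] by (simp add: set_lebesgue_integral_def)
  finally show ?thesis ..
qed

definition laplace :: "real \<Rightarrow> (real \<Rightarrow>\<^sub>C real) \<Rightarrow> real"
  where "laplace k G = integral {0..} (\<lambda>u. exp (- k * u) * apply_bcontfun G u)"

lemma laplace_integrable_bcontfun:
  fixes G :: "real \<Rightarrow>\<^sub>C real"
  assumes "k > 0"
  shows "(\<lambda>u. exp (- k * u) * apply_bcontfun G u) absolutely_integrable_on {c..}"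
  using norm_bounded[of G] by (intro laplace_integrable[OF assms, where C = "norm G"]) auto

text \<open>The norm is at most 1 / k, and convergence is where k > 0 enters. Boundedness reduces
  smoothness of the transform in a parameter to smoothness of the transformed curve.\<close>

lemma bounded_linear_laplace:
  assumes k: "k > 0"
  shows "bounded_linear (laplace k)"
proof (rule bounded_linear_intro[where K = "1 / k"])
  note i = set_lebesgue_integral_eq_integral(1)[OF laplace_integrable_bcontfun[OF k]]
  show "laplace k (G + H) = laplace k G + laplace k H" for G H
    using integral_add[OF i[of G] i[of H]] unfolding laplace_def by (simp add: distrib_left)
  show "laplace k (r *\<^sub>R G) = r *\<^sub>R laplace k G" for r G
    unfolding laplace_def by (simp add: mult.left_commute[of _ r])
  show "norm (laplace k G) \<le> norm G * (1 / k)" for G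
  proof -
    have e: "((\<lambda>u. norm G * exp (- k * u)) has_integral norm G * (exp (- k * 0) / k)) {0..}"
      using has_integral_exp_minus_to_infinity[OF k, of 0] by (rule has_integral_mult_right)
    have "norm (laplace k G) \<le> integral {0..} (\<lambda>u. norm G * exp (- k * u))"
      unfolding laplace_def
    proof (rule integral_norm_bound_integral[OF i])
      show "(\<lambda>u. norm G * exp (- k * u)) integrable_on {0..}" using e by (auto simp: integrable_on_def)
      show "norm (exp (- k * u) * apply_bcontfun G u) \<le> norm G * exp (- k * u)" for u
        using mult_right_mono[OF norm_bounded[of G u], of "exp (- k * u)"] by (simp add: abs_mult mult.commute)
    qed
    then show ?thesis using integral_unique[OF e] by simp
  qed
qed

text \<open>The part over [0, s] is split off. The parameter 1 - k turns the weight exp ((m - 1) r)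
  of \<open>damped_integral\<close> into exp (- k r), so that its known derivative at 0
  applies.\<close>

lemma laplace_shift:
  assumes k: "k > 0" and s: "s \<ge> 0"
  shows "integral {0..} (\<lambda>u. exp (- k * u) * apply_bcontfun G (u + s)) =
    exp (k * s) * laplace k G - exp s * damped_integral (1 - k) (apply_bcontfun G) s"
proof -
  define h where "h u = exp (- k * u) * apply_bcontfun G u" for u
  have h: "h absolutely_integrable_on {c..}" for c
    unfolding h_def by (rule laplace_integrable_bcontfun[OF k])
  have hs: "(\<lambda>u. exp (- k * u) * apply_bcontfun G (u + s)) absolutely_integrable_on {0..}"
    using norm_bounded[of G]
    by (intro laplace_integrable[OF k, where C = "norm G"])
      (auto intro!: continuous_on_compose2[OF continuous_on_apply_bcontfun[of UNIV]] continuous_intros)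
  have heq: "h (u + s) = exp (- k * s) * (exp (- k * u) * apply_bcontfun G (u + s))" for u
    by (simp add: h_def distrib_left exp_add mult_ac) (simp add: exp_add[symmetric] algebra_simps)
  have hs': "(\<lambda>u. h (u + s)) absolutely_integrable_on {0..}"
    unfolding heq using hs by (rule set_integrable_mult_right)
  have "integral {0..} h = integral {0..s} h + integral {s..} h"
  proof -
    have "integral ({0..s} \<union> {s..}) h = integral {0..s} h + integral {s..} h"
    proof (rule integral_Un)
      show "h integrable_on {0..s}"
        unfolding h_def by (intro integrable_continuous_real continuous_intros) auto
      show "h integrable_on {s..}" using set_lebesgue_integral_eq_integral(1)[OF h] .
      have "{0..s} \<inter> {s..} = {s}" using s by auto
      then show "negligible ({0..s} \<inter> {s..})" by simp
    qed
    moreover have "{0..s} \<union> {s..} = {0..}" using s by auto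
    ultimately show ?thesis by simp
  qed
  moreover have "integral {s..} h = exp (- k * s) * integral {0..} (\<lambda>u. exp (- k * u) * apply_bcontfun G (u + s))"
    using integral_atLeast_shift[OF h hs'] by (simp add: heq)
  ultimately have "exp (- k * s) * integral {0..} (\<lambda>u. exp (- k * u) * apply_bcontfun G (u + s)) =
      laplace k G - integral {0..s} h"
    by (simp add: laplace_def h_def[abs_def])
  then have "exp (k * s) * (exp (- k * s) * integral {0..} (\<lambda>u. exp (- k * u) * apply_bcontfun G (u + s))) =
      exp (k * s) * laplace k G - exp (k * s) * integral {0..s} h"
    by (simp add: right_diff_distrib)
  moreover have "exp (k * s) * exp (- k * s) = 1" by (simp add: exp_add[symmetric])
  moreover have "exp s * damped_integral (1 - k) (apply_bcontfun G) s = exp (k * s) * integral {0..s} h"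
    using s by (simp add: damped_integral_def h_def[abs_def] exp_add[symmetric] mult.assoc[symmetric] algebra_simps)
  ultimately show ?thesis by (simp add: mult.assoc[symmetric])
qed

lemma frechet_derivativeI: "(f has_derivative D) (at x) \<Longrightarrow> frechet_derivative f (at x) = D"
  by (metis frechet_derivative_at)

section \<open>The derivation along \<open>V\<close> on germs, and the equation V c + k c =
  F\<close>

context resonant_field
begin

text \<open>The equation V u = du between germs, kept as a relation so that sum and product rules
  compose and \<open>lie_cong\<close> simplifies the right-hand side at the end.\<close>

definition lie :: "(real \<times> real \<times> real \<Rightarrow> real) \<Rightarrow> (real \<times> real \<times> real \<Rightarrow> real) \<Rightarrow> bool"
  where "lie u du \<longleftrightarrow> smooth_near a\<^sub>0 u \<and> (\<forall>\<^sub>F q in nhds a\<^sub>0. frechet_derivative u (at q) (V q) = du q)"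

lemma lie_smooth: "lie u du \<Longrightarrow> smooth_near a\<^sub>0 u"
  by (simp add: lie_def)

lemma lie_cong: "lie u du \<Longrightarrow> \<forall>\<^sub>F q in nhds a\<^sub>0. du q = dv q \<Longrightarrow> lie u dv"
  unfolding lie_def by (auto elim: eventually_elim2)

lemma lieI:
  assumes "smooth_near a\<^sub>0 u" "\<forall>\<^sub>F q in nhds a\<^sub>0. (u has_derivative D q) (at q) \<and> D q (V q) = du q"
  shows "lie u du"
  unfolding lie_def using assms by (auto elim!: eventually_mono simp: frechet_derivativeI)

lemma lie_has_derivative:
  assumes "lie u du"
  shows "\<forall>\<^sub>F q in nhds a\<^sub>0. (u has_derivative frechet_derivative u (at q)) (at q) \<and> frechet_derivative u (at q) (V q) = du q"
  using eventually_conj[OF smooth_near_has_derivative[OF lie_smooth[OF assms]]] assms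
  unfolding lie_def by blast

lemma lie_add:
  assumes "lie u du" "lie v dv"
  shows "lie (\<lambda>q. u q + v q) (\<lambda>q. du q + dv q)"
proof (rule lieI)
  show "\<forall>\<^sub>F q in nhds a\<^sub>0. ((\<lambda>q. u q + v q) has_derivative
      (\<lambda>h. frechet_derivative u (at q) h + frechet_derivative v (at q) h)) (at q) \<and>
      frechet_derivative u (at q) (V q) + frechet_derivative v (at q) (V q) = du q + dv q"
    using lie_has_derivative[OF assms(1)] lie_has_derivative[OF assms(2)]
    by eventually_elim (auto intro: has_derivative_add)
qed (intro smooth_near_add lie_smooth[OF assms(1)] lie_smooth[OF assms(2)])

lemma lie_mult:
  assumes "lie u du" "lie v dv"
  shows "lie (\<lambda>q. u q * v q) (\<lambda>q. u q * dv q + du q * v q)"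
proof (rule lieI)
  show "\<forall>\<^sub>F q in nhds a\<^sub>0. ((\<lambda>q. u q * v q) has_derivative
      (\<lambda>h. u q * frechet_derivative v (at q) h + frechet_derivative u (at q) h * v q)) (at q) \<and>
      u q * frechet_derivative v (at q) (V q) + frechet_derivative u (at q) (V q) * v q = u q * dv q + du q * v q"
    using lie_has_derivative[OF assms(1)] lie_has_derivative[OF assms(2)]
    by eventually_elim (auto intro: has_derivative_mult)
qed (intro smooth_near_mult lie_smooth[OF assms(1)] lie_smooth[OF assms(2)])

lemma lie_const: "lie (\<lambda>q. c) (\<lambda>q. 0)"
  by (rule lieI[where D = "\<lambda>_ _. 0"]) auto

lemma lie_minus:
  assumes "lie u du"
  shows "lie (\<lambda>q. - u q) (\<lambda>q. - du q)"
  using lie_mult[OF lie_const[of "-1"] assms] by simp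

lemma lie_diff:
  assumes "lie u du" "lie v dv"
  shows "lie (\<lambda>q. u q - v q) (\<lambda>q. du q - dv q)"
  using lie_add[OF assms(1) lie_minus[OF assms(2)]] by simp

lemma lie_t: "lie fst fst"
  by (rule lieI[where D = "\<lambda>_. fst"]) (auto intro!: smooth_near_intros always_eventually bounded_linear_imp_has_derivative[OF bounded_linear_fst] simp: V_def)

lemma lie_x: "lie (\<lambda>q. fst (snd q)) (\<lambda>q. fst q * f q)"
  by (rule lieI[where D = "\<lambda>_ h. fst (snd h)"])
    (auto intro!: smooth_near_intros always_eventually simp: V_def
      bounded_linear_imp_has_derivative[OF bounded_linear_compose[OF bounded_linear_fst bounded_linear_snd]])

lemma lie_p: "lie (\<lambda>q. snd (snd q)) (\<lambda>q. real n * snd (snd q) + fst q * g q)"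
  by (rule lieI[where D = "\<lambda>_ h. snd (snd h)"])
    (auto intro!: smooth_near_intros always_eventually simp: V_def
      bounded_linear_imp_has_derivative[OF bounded_linear_compose[OF bounded_linear_snd bounded_linear_snd]])

lemma lie_t_power: "lie (\<lambda>q. fst q ^ k) (\<lambda>q. real k * fst q ^ k)"
proof (induction k)
  case 0
  show ?case using lie_const[of 1] by simp
next
  case (Suc k)
  show ?case
    by (rule lie_cong[OF lie_mult[OF lie_t Suc, folded power_Suc]])
      (auto intro!: always_eventually simp: algebra_simps)
qed

lemma lie_compose_0:
  assumes "lie \<zeta> (\<lambda>_. 0)" "smooth_near (\<zeta> a\<^sub>0) \<rho>"
  shows "lie (\<lambda>q. \<rho> (\<zeta> q)) (\<lambda>_. 0)"
proof (rule lieI)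
  have "\<forall>\<^sub>F z in nhds (\<zeta> a\<^sub>0). (\<rho> has_derivative frechet_derivative \<rho> (at z)) (at z)"
    using smooth_near_has_derivative[OF assms(2)] .
  moreover have "filterlim \<zeta> (nhds (\<zeta> a\<^sub>0)) (nhds a\<^sub>0)"
    using smooth_near_isCont[OF lie_smooth[OF assms(1)]] by (simp add: isCont_def tendsto_nhds_iff)
  ultimately have "\<forall>\<^sub>F q in nhds a\<^sub>0. (\<rho> has_derivative frechet_derivative \<rho> (at (\<zeta> q))) (at (\<zeta> q))"
    unfolding filterlim_iff by blast
  with lie_has_derivative[OF assms(1)]
  show "\<forall>\<^sub>F q in nhds a\<^sub>0. ((\<lambda>q. \<rho> (\<zeta> q)) has_derivative
      (\<lambda>h. frechet_derivative \<rho> (at (\<zeta> q)) (frechet_derivative \<zeta> (at q) h))) (at q) \<and>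
      frechet_derivative \<rho> (at (\<zeta> q)) (frechet_derivative \<zeta> (at q) (V q)) = 0"
    by eventually_elim (auto intro: has_derivative_compose simp: linear_0[OF has_derivative_linear])
qed (rule smooth_near_compose[OF lie_smooth[OF assms(1)] assms(2)])

text \<open>By the semigroup law, c at time s of the backward orbit of q is exp (k s) times the
  difference of c(q) and the integral over [0, s] of exp (- k u) F along the orbit. The right
  derivative of this at 0 is k c - F, whereas the chain rule gives - V c.\<close>

lemma cohomological_equation:
  assumes F: "smooth_near a\<^sub>0 F" and k: "k > (0::real)"
  obtains c where "lie c (\<lambda>q. F q - k * c q)"
proof -
  obtain w S where S: "open S" "a\<^sub>0 \<in> S" and w: "smooth_on S w" "w a\<^sub>0 = const_bcontfun a\<^sub>0"
    and w0: "\<And>q. q \<in> S \<Longrightarrow> apply_bcontfun (w q) 0 = q"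
    and semi: "\<And>q s u. q \<in> S \<Longrightarrow> s \<ge> 0 \<Longrightarrow> apply_bcontfun (w q) s \<in> S \<Longrightarrow> u \<ge> 0 \<Longrightarrow>
       apply_bcontfun (w (apply_bcontfun (w q) s)) u = apply_bcontfun (w q) (u + s)"
    and der: "\<And>q. q \<in> S \<Longrightarrow> (apply_bcontfun (w q) has_vector_derivative - V q) (at 0 within {0..})"
    by (rule flow_exists) (rule that, assumption+)
  have ws: "smooth_near a\<^sub>0 w" using S w(1) smooth_nearI by blast
  define c where "c q = laplace k (superposition F (w q))" for q
  have cs: "smooth_near a\<^sub>0 c"
    unfolding c_def
    by (rule smooth_near_bounded_linear_comp[OF bounded_linear_laplace[OF k] smooth_near_superposition(1)[OF ws F w(2)]])
  have "\<forall>\<^sub>F q in nhds a\<^sub>0. q \<in> S \<and> (c has_derivative frechet_derivative c (at q)) (at q)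
      \<and> (\<forall>s. apply_bcontfun (superposition F (w q)) s = F (w q s))"
    using eventually_nhds_in_open[OF S] smooth_near_has_derivative[OF cs] smooth_near_superposition(2)[OF ws F w(2)]
    by eventually_elim blast
  then obtain T where T: "open T" "a\<^sub>0 \<in> T" "\<And>q. q \<in> T \<Longrightarrow> q \<in> S"
    "\<And>q. q \<in> T \<Longrightarrow> (c has_derivative frechet_derivative c (at q)) (at q)"
    "\<And>q s. q \<in> T \<Longrightarrow> apply_bcontfun (superposition F (w q)) s = F (w q s)"
    unfolding eventually_nhds by blast
  have "frechet_derivative c (at q) (V q) = F q - k * c q" if q: "q \<in> T" for q
  proof -
    define \<gamma> where "\<gamma> = apply_bcontfun (w q)"
    define G where "G = superposition F (w q)"
    have G: "apply_bcontfun G s = F (\<gamma> s)" for s unfolding G_def \<gamma>_def using T(5)[OF q] .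
    have \<gamma>0: "\<gamma> 0 = q" unfolding \<gamma>_def using w0 T(3)[OF q] .
    have d\<gamma>: "(\<gamma> has_derivative (\<lambda>s. s *\<^sub>R - V q)) (at 0 within {0..})"
      using der[OF T(3)[OF q]] unfolding \<gamma>_def has_vector_derivative_def .
    have "((\<lambda>s. c (\<gamma> s)) has_derivative (\<lambda>s. frechet_derivative c (at q) (s *\<^sub>R - V q))) (at 0 within {0..})"
      using has_derivative_compose[OF d\<gamma>, of c] T(4)[OF q] \<gamma>0 by simp
    then have 1: "((\<lambda>s. c (\<gamma> s)) has_vector_derivative - frechet_derivative c (at q) (V q)) (at 0 within {0..})"
      unfolding has_vector_derivative_def
      using has_derivative_linear[OF T(4)[OF q]] by (simp add: linear_neg linear_scale)
    \<comment> \<open>The formula for \<open>c\<close> along the orbit needs the orbit to be in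
      \<open>T\<close>; small \<open>s\<close> are enough for a derivative at 0.\<close>
    have ev: "\<forall>\<^sub>F s in at 0 within {0..}. \<gamma> s \<in> T"
    proof -
      have "continuous (at 0 within {0..}) \<gamma>" using d\<gamma> has_derivative_continuous by blast
      then have "(\<gamma> \<longlongrightarrow> q) (at 0 within {0..})" by (simp add: continuous_within \<gamma>0)
      then show ?thesis using topological_tendstoD T(1) q by blast
    qed
    have form: "c (\<gamma> s) = exp (k * s) * c q - exp s * damped_integral (1 - k) (apply_bcontfun G) s"
      if s: "s \<ge> 0" "\<gamma> s \<in> T" for s
    proof -
      have "c (\<gamma> s) = integral {0..} (\<lambda>u. exp (- k * u) * apply_bcontfun G (u + s))"
        unfolding c_def laplace_def
      proof (rule integral_cong)
        fix u :: real assume "u \<in> {0..}"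
        then have "apply_bcontfun (w (\<gamma> s)) u = \<gamma> (u + s)"
          using semi[OF T(3)[OF q] s(1) T(3)] s(2) unfolding \<gamma>_def by auto
        then show "exp (- k * u) * apply_bcontfun (superposition F (w (\<gamma> s))) u = exp (- k * u) * apply_bcontfun G (u + s)"
          by (simp add: T(5)[OF s(2)] G)
      qed
      also have "\<dots> = exp (k * s) * laplace k G - exp s * damped_integral (1 - k) (apply_bcontfun G) s"
        by (rule laplace_shift[OF k s(1)])
      finally show ?thesis by (simp add: c_def G_def)
    qed
    have "((\<lambda>s. exp (k * s) * c q - exp s * damped_integral (1 - k) (apply_bcontfun G) s) has_real_derivative
        k * c q - F q) (at 0 within {0..})"
    proof -
      have "(damped_integral (1 - k) (apply_bcontfun G) has_real_derivative F q) (at 0 within {0..})"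
        using damped_integral_derivative_0[of "apply_bcontfun G" "1 - k"] G[of 0] \<gamma>0
        by (simp add: has_real_derivative_iff_has_vector_derivative)
      moreover have "damped_integral (1 - k) (apply_bcontfun G) 0 = 0" by (simp add: damped_integral_def)
      ultimately show ?thesis
        by (auto intro!: derivative_eq_intros)
    qed
    then have 2: "((\<lambda>s. c (\<gamma> s)) has_vector_derivative k * c q - F q) (at 0 within {0..})"
      unfolding has_real_derivative_iff_has_vector_derivative has_vector_derivative_def
    proof (rule has_derivative_transform_eventually)
      show "\<forall>\<^sub>F s in at 0 within {0..}. exp (k * s) * c q - exp s * damped_integral (1 - k) (apply_bcontfun G) s = c (\<gamma> s)"
      proof -
        have "\<forall>\<^sub>F s in at 0 within {0..}. s \<in> {0::real..}" by (simp add: eventually_at_filter)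
        with ev show ?thesis by eventually_elim (simp add: form)
      qed
      show "exp (k * 0) * c q - exp 0 * damped_integral (1 - k) (apply_bcontfun G) 0 = c (\<gamma> 0)"
        using form[of 0] \<gamma>0 q by simp
    qed simp
    have "at 0 within {0::real..} \<noteq> bot"
      by (simp add: at_within_Ici_at_right trivial_limit_at_right_real)
    from vector_derivative_unique_within[OF this 1 2] show ?thesis by simp
  qed
  then have "\<forall>\<^sub>F q in nhds a\<^sub>0. frechet_derivative c (at q) (V q) = F q - k * c q"
    unfolding eventually_nhds using T(1,2) by blast
  then show thesis using that cs by (simp add: lie_def)
qed

end

subsection \<open>Reduction to normal form\<close>

lemma hadamard_triple:
  fixes R :: "real \<times> real \<times> real \<Rightarrow> real"
  assumes R: "smooth_near p R"
  obtains H1 H2 H3 where "smooth_near (p, p) H1" "smooth_near (p, p) H2" "smooth_near (p, p) H3"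
    "\<forall>\<^sub>F (u, v) in nhds (p, p). R u - R v = H1 (u, v) * (fst u - fst v)
       + H2 (u, v) * (fst (snd u) - fst (snd v)) + H3 (u, v) * (snd (snd u) - snd (snd v))"
proof -
  obtain H where H: "\<forall>b\<in>Basis. smooth_near (p, p) (H b)"
    and eq: "\<forall>\<^sub>F (u, v) in nhds (p, p). R u - R v = (\<Sum>b\<in>Basis. H b (u, v) * ((u - v) \<bullet> b))"
    using hadamard[OF R] by blast
  have B: "(Basis :: (real \<times> real \<times> real) set) = {(1, 0, 0), (0, 1, 0), (0, 0, 1)}"
    by (auto simp: Basis_prod_def image_iff zero_prod_def)
  have sum3: "(\<Sum>b\<in>Basis. G b) = G (1, 0, 0) + G (0, 1, 0) + G (0, 0, 1)" for G :: "real \<times> real \<times> real \<Rightarrow> real"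
    unfolding B by simp
  show thesis
  proof (rule that)
    show "\<forall>\<^sub>F (u, v) in nhds (p, p). R u - R v = H (1, 0, 0) (u, v) * (fst u - fst v)
       + H (0, 1, 0) (u, v) * (fst (snd u) - fst (snd v)) + H (0, 0, 1) (u, v) * (snd (snd u) - snd (snd v))"
      using eq unfolding sum3 by (simp add: inner_prod_def case_prod_unfold)
  qed (use H B in auto)
qed

context resonant_field
begin

text \<open>From V z = f - z and V t = t the product rule gives V (t z) = t f, which is V x.\<close>

lemma first_integral:
  obtains z where "smooth_near a\<^sub>0 z" "lie (\<lambda>q. fst (snd q) - fst q * z q) (\<lambda>_. 0)"
proof -
  obtain z where z: "lie z (\<lambda>q. f q - 1 * z q)"
    using cohomological_equation[OF f, of 1] by auto
  have "lie (\<lambda>q. fst (snd q) - fst q * z q) (\<lambda>_. 0)"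
    by (rule lie_cong[OF lie_diff[OF lie_x lie_mult[OF lie_t z]]])
      (auto intro!: always_eventually simp: algebra_simps)
  with lie_smooth[OF z] show thesis by (rule that)
qed

text \<open>Hadamard's formula is applied between q and (0, \<zeta>(q), 0). The coordinate
  differences are t, x - \<zeta> = t z and P, so the x-term joins the t-term with an extra factor
  \<open>z\<close>.\<close>

lemma split_remainder:
  assumes R: "smooth_near a\<^sub>0 R" and z: "smooth_near a\<^sub>0 z"
  obtains R1 R2 where "smooth_near a\<^sub>0 R1" "smooth_near a\<^sub>0 R2"
    "\<forall>\<^sub>F q in nhds a\<^sub>0. R q = R (0, fst (snd q) - fst q * z q, 0) + fst q * R2 q + snd (snd q) * R1 q"
proof -
  obtain H1 H2 H3 where H: "smooth_near (a\<^sub>0, a\<^sub>0) H1" "smooth_near (a\<^sub>0, a\<^sub>0) H2" "smooth_near (a\<^sub>0, a\<^sub>0) H3"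
    and eq: "\<forall>\<^sub>F (u, v) in nhds (a\<^sub>0, a\<^sub>0). R u - R v = H1 (u, v) * (fst u - fst v)
       + H2 (u, v) * (fst (snd u) - fst (snd v)) + H3 (u, v) * (snd (snd u) - snd (snd v))"
    by (rule hadamard_triple[OF R])
  define j where "j q = (q, (0 :: real, fst (snd q) - fst q * z q, 0 :: real))" for q
  have js: "smooth_near a\<^sub>0 j"
    unfolding j_def by (intro smooth_near_intros z)
  have ja: "j a\<^sub>0 = (a\<^sub>0, a\<^sub>0)" by (simp add: j_def)
  have Hs: "smooth_near a\<^sub>0 (\<lambda>q. h (j q))" if "smooth_near (a\<^sub>0, a\<^sub>0) h" for h :: "_ \<Rightarrow> real"
    by (rule smooth_near_compose[OF js]) (use that ja in simp)
  have "filterlim j (nhds (a\<^sub>0, a\<^sub>0)) (nhds a\<^sub>0)"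
    using smooth_near_isCont[OF js] by (simp add: isCont_def tendsto_nhds_iff ja)
  then have ev: "\<forall>\<^sub>F q in nhds a\<^sub>0. case j q of (u, v) \<Rightarrow> R u - R v = H1 (u, v) * (fst u - fst v)
       + H2 (u, v) * (fst (snd u) - fst (snd v)) + H3 (u, v) * (snd (snd u) - snd (snd v))"
    using eq unfolding filterlim_iff by blast
  show thesis
  proof (rule that)
    show "smooth_near a\<^sub>0 (\<lambda>q. H3 (j q))" by (rule Hs[OF H(3)])
    show "smooth_near a\<^sub>0 (\<lambda>q. H1 (j q) + z q * H2 (j q))"
      by (intro smooth_near_add smooth_near_mult Hs H z)
    show "\<forall>\<^sub>F q in nhds a\<^sub>0. R q = R (0, fst (snd q) - fst q * z q, 0)
        + fst q * (H1 (j q) + z q * H2 (j q)) + snd (snd q) * H3 (j q)"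
      using ev by eventually_elim (simp add: j_def algebra_simps)
  qed
qed

text \<open>The correction is t^k c with c = P c1 + e \<rho>. Since V (P c1) + (k - n) P c1 = P R1 +
  t g c1, its first part cancels P R1 and adds - g c1 to the next remainder; since V \<rho> = 0, its
  second part changes the coefficient of \<rho> by (k - n) e. Keeping the form P + t s makes the
  final chart invertible.\<close>

lemma normalize_step:
  assumes k: "k \<ge> 1"
    and z: "smooth_near a\<^sub>0 z" and \<zeta>: "lie (\<lambda>q. fst (snd q) - fst q * z q) (\<lambda>_. 0)"
    and R: "smooth_near a\<^sub>0 R" and s: "smooth_near a\<^sub>0 s"
    and u: "lie (\<lambda>q. snd (snd q) + fst q * s q)
        (\<lambda>q. real n * (snd (snd q) + fst q * s q) + fst q ^ k * R q)"
  obtains R' s' where "smooth_near a\<^sub>0 R'" "smooth_near a\<^sub>0 s'"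
    "lie (\<lambda>q. snd (snd q) + fst q * s' q)
      (\<lambda>q. real n * (snd (snd q) + fst q * s' q) + fst q ^ Suc k * R' q
        + (if k = n then fst q ^ n * R (0, fst (snd q) - fst q * z q, 0) else 0))"
proof -
  obtain R1 R2 where R12: "smooth_near a\<^sub>0 R1" "smooth_near a\<^sub>0 R2"
    and split: "\<forall>\<^sub>F q in nhds a\<^sub>0. R q = R (0, fst (snd q) - fst q * z q, 0) + fst q * R2 q + snd (snd q) * R1 q"
    by (rule split_remainder[OF R z])
  obtain c1 where c1: "lie c1 (\<lambda>q. R1 q - real k * c1 q)"
    using cohomological_equation[OF R12(1), of "real k"] k by auto
  define \<rho> where "\<rho> q = R (0, fst (snd q) - fst q * z q, 0)" for q :: "real \<times> real \<times> real"
  have "smooth_near x\<^sub>0 (\<lambda>y. R (0, y, 0))"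
    by (rule smooth_near_compose[where f = "\<lambda>y. (0, y, 0)"]) (use R in \<open>auto intro!: smooth_near_intros\<close>)
  then have \<rho>: "lie \<rho> (\<lambda>_. 0)"
    unfolding \<rho>_def by (intro lie_compose_0[OF \<zeta>, of "\<lambda>y. R (0, y, 0)"]) simp
  \<comment> \<open>the division by \<open>0\<close> for \<open>k = n\<close> gives \<open>e = 0\<close>, which leaves the resonant term untouched\<close>
  define e where "e = 1 / (real k - real n)"
  define c where "c q = snd (snd q) * c1 q + e * \<rho> q" for q
  have c: "lie c (\<lambda>q. snd (snd q) * (R1 q - real k * c1 q) + (real n * snd (snd q) + fst q * g q) * c1 q)"
    unfolding c_def
    by (rule lie_cong[OF lie_add[OF lie_mult[OF lie_p c1] lie_mult[OF lie_const \<rho>]]]) simp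
  have ek: "(real k - real n) * e = (if k = n then 0 else 1)"
    by (simp add: e_def)
  \<comment> \<open>As k \<ge> 1, the correction t^k c contains the factor t that the form P + t s
    demands.\<close>
  define s' where "s' q = s q - fst q ^ (k - 1) * c q" for q
  have tk: "t ^ k = t * t ^ (k - 1)" for t :: real
    using k by (metis One_nat_def Suc_le_D diff_Suc_1 power_Suc)
  have u': "(\<lambda>q. snd (snd q) + fst q * s' q) = (\<lambda>q. (snd (snd q) + fst q * s q) - fst q ^ k * c q)"
    by (auto simp: s'_def tk algebra_simps)
  show thesis
  proof (rule that)
    show "smooth_near a\<^sub>0 (\<lambda>q. R2 q - g q * c1 q)"
      by (intro smooth_near_diff smooth_near_mult R12 g lie_smooth[OF c1])
    show "smooth_near a\<^sub>0 s'"
      unfolding s'_def by (intro smooth_near_intros s lie_smooth[OF c])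
    show "lie (\<lambda>q. snd (snd q) + fst q * s' q)
      (\<lambda>q. real n * (snd (snd q) + fst q * s' q) + fst q ^ Suc k * (R2 q - g q * c1 q)
        + (if k = n then fst q ^ n * R (0, fst (snd q) - fst q * z q, 0) else 0))"
      unfolding u'
    proof (rule lie_cong[OF lie_diff[OF u lie_mult[OF lie_t_power c]]])
      show "\<forall>\<^sub>F q in nhds a\<^sub>0. real n * (snd (snd q) + fst q * s q) + fst q ^ k * R q -
          (fst q ^ k * (snd (snd q) * (R1 q - real k * c1 q) + (real n * snd (snd q) + fst q * g q) * c1 q) +
           real k * fst q ^ k * c q) =
         real n * (snd (snd q) + fst q * s' q) + fst q ^ Suc k * (R2 q - g q * c1 q)
        + (if k = n then fst q ^ n * R (0, fst (snd q) - fst q * z q, 0) else 0)"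
        using split
      proof eventually_elim
        case (elim q)
        have u'q: "snd (snd q) + fst q * s' q = snd (snd q) + fst q * s q - fst q ^ k * c q"
          using fun_cong[OF u', of q] .
        have "(if k = n then fst q ^ n * \<rho> q else 0) = fst q ^ k * (\<rho> q - (real k - real n) * e * \<rho> q)"
          unfolding ek by simp
        then show ?case
          unfolding u'q elim \<rho>_def[symmetric] by (simp add: c_def algebra_simps)
      qed
    qed
  qed
qed

lemma normal_coordinates:
  obtains s z \<rho> where "smooth_near a\<^sub>0 s" "smooth_near a\<^sub>0 z" "smooth_near x\<^sub>0 \<rho>"
    "lie (\<lambda>q. fst (snd q) - fst q * z q) (\<lambda>_. 0)"
    "lie (\<lambda>q. snd (snd q) + fst q * s q)
      (\<lambda>q. real n * (snd (snd q) + fst q * s q) + \<rho> (fst (snd q) - fst q * z q) * fst q ^ n)"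
proof -
  obtain z where z: "smooth_near a\<^sub>0 z" "lie (\<lambda>q. fst (snd q) - fst q * z q) (\<lambda>_. 0)"
    by (rule first_integral)
  have "\<exists>R s. smooth_near a\<^sub>0 R \<and> smooth_near a\<^sub>0 s \<and> lie (\<lambda>q. snd (snd q) + fst q * s q)
      (\<lambda>q. real n * (snd (snd q) + fst q * s q) + fst q ^ k * R q)" if "1 \<le> k" "k \<le> n" for k
    using that
  proof (induction k rule: dec_induct)
    case base
    show ?case
      using lie_p by (intro exI[of _ g] exI[of _ "\<lambda>_. 0"]) (simp add: g)
  next
    case (step k)
    then obtain R s where R: "smooth_near a\<^sub>0 R" and s: "smooth_near a\<^sub>0 s"
      and u: "lie (\<lambda>q. snd (snd q) + fst q * s q) (\<lambda>q. real n * (snd (snd q) + fst q * s q) + fst q ^ k * R q)"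
      by auto
    obtain R' s' where "smooth_near a\<^sub>0 R'" "smooth_near a\<^sub>0 s'"
      "lie (\<lambda>q. snd (snd q) + fst q * s' q)
        (\<lambda>q. real n * (snd (snd q) + fst q * s' q) + fst q ^ Suc k * R' q
          + (if k = n then fst q ^ n * R (0, fst (snd q) - fst q * z q, 0) else 0))"
      by (rule normalize_step[OF step(1) z R s u])
    then show ?case using step(4) by auto
  qed
  then obtain R s where R: "smooth_near a\<^sub>0 R" and s: "smooth_near a\<^sub>0 s"
    and u: "lie (\<lambda>q. snd (snd q) + fst q * s q) (\<lambda>q. real n * (snd (snd q) + fst q * s q) + fst q ^ n * R q)"
    using n by blast
  obtain R' s' where R': "smooth_near a\<^sub>0 R'" and s': "smooth_near a\<^sub>0 s'" and
    u': "lie (\<lambda>q. snd (snd q) + fst q * s' q)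
      (\<lambda>q. real n * (snd (snd q) + fst q * s' q) + fst q ^ Suc n * R' q
        + (if n = n then fst q ^ n * R (0, fst (snd q) - fst q * z q, 0) else 0))"
    by (rule normalize_step[OF n z R s u])
  \<comment> \<open>The constant 1 is the excess of the order n + 1 over the eigenvalue n: V
    (t^(n+1) c) - n t^(n+1) c = t^(n+1) (c + V c) = t^(n+1) R'.\<close>
  obtain c where c: "lie c (\<lambda>q. R' q - 1 * c q)"
    using cohomological_equation[OF R', of 1] by auto
  define s'' where "s'' q = s' q - fst q ^ n * c q" for q
  have eq: "(\<lambda>q. snd (snd q) + fst q * s'' q) = (\<lambda>q. (snd (snd q) + fst q * s' q) - fst q ^ Suc n * c q)"
    by (auto simp: s''_def algebra_simps)
  show thesis
  proof (rule that)
    show "smooth_near a\<^sub>0 s''"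
      unfolding s''_def by (intro smooth_near_intros s' lie_smooth[OF c])
    show "smooth_near x\<^sub>0 (\<lambda>y. R (0, y, 0))"
      by (rule smooth_near_compose[where f = "\<lambda>y. (0, y, 0)"]) (use R in \<open>auto intro!: smooth_near_intros\<close>)
    show "lie (\<lambda>q. snd (snd q) + fst q * s'' q)
      (\<lambda>q. real n * (snd (snd q) + fst q * s'' q) + R (0, fst (snd q) - fst q * z q, 0) * fst q ^ n)"
      unfolding eq
      by (rule lie_cong[OF lie_diff[OF u' lie_mult[OF lie_t_power c]]])
        (auto intro!: always_eventually simp: s''_def algebra_simps)
  qed (use z in auto)
qed

end

subsection \<open>The geodesic field\<close>

text \<open>Smoothness of the inverse \<open>g\<close> comes from the fixed-point lemma: its
  derivative applied to v solves z = (1 - B f'(g)) z + B v, whose operator is small near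
  \<open>a\<close> because B f'(a) = 1. Each order of \<open>g\<close> then yields the next.\<close>

lemma smooth_local_diffeomorphism:
  fixes F :: "'a::euclidean_space \<Rightarrow> 'a"
  assumes F: "smooth_near a F" and A: "(F has_derivative A) (at a)"
    and B: "bounded_linear B" "\<And>v. B (A v) = v"
    and T: "open T" "a \<in> T"
  obtains U W where "diffeomorphism U W F" "a \<in> U" "U \<subseteq> T"
proof -
  obtain S where S: "open S" "a \<in> S" "smooth_on S F" using F unfolding smooth_near_def by blast
  \<comment> \<open>\<open>mk b u\<close> is the rank-one operator taking v to (v \<bullet> b) u;
    sums of these assemble the derivative as an operator-valued smooth map.\<close>
  define mk where "mk b = (\<lambda>u :: 'a. blinfun_scaleR_left u o\<^sub>L blinfun_inner_left b)" for b :: 'a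
  have mk: "bounded_linear (mk b :: 'a \<Rightarrow> _)" for b
    unfolding mk_def
    by (rule bounded_linear_compose[OF bounded_bilinear.bounded_linear_left[OF bounded_bilinear_blinfun_compose]
          bounded_linear_blinfun_scaleR_left])
  define f' where "f' x = (\<Sum>b\<in>Basis. mk b (frechet_derivative F (at x) b))" for x
  have f': "blinfun_apply (f' x) = frechet_derivative F (at x)" if "x \<in> S" for x
  proof
    fix v
    have "linear (frechet_derivative F (at x))"
      using has_derivative_linear[OF smooth_on_has_derivative[OF S(3) that]] .
    from linear_euclidean_sum[OF this, of v] show "blinfun_apply (f' x) v = frechet_derivative F (at x) v"
      by (simp add: f'_def blinfun.sum_left mk_def blinfun_inner_left.rep_eq)
  qed
  have f's: "Ck_on k S f'" for k
    unfolding f'_def by (intro Ck_on_sum S Ck_on_bounded_linear_comp[OF mk] smooth_onD[OF smooth_on_frechet[OF S(3)]])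
  define invf where "invf = Blinfun B"
  have invf: "blinfun_apply invf = B"
    unfolding invf_def by (rule bounded_linear_Blinfun_apply[OF B(1)])
  define L where "L x = id_blinfun - (invf o\<^sub>L f' x)" for x
  have Ls: "Ck_on k S L" for k
  proof -
    have "Ck_on k S (\<lambda>x. id_blinfun + - (invf o\<^sub>L f' x))"
      by (intro Ck_on_add S Ck_on_const Ck_on_bounded_linear_comp[OF bounded_linear_minus[OF bounded_linear_ident]]
          Ck_on_bounded_linear_comp[OF bounded_bilinear.bounded_linear_right[OF bounded_bilinear_blinfun_compose]] f's)
    then show ?thesis by (simp add: L_def[abs_def])
  qed
  have fa: "frechet_derivative F (at a) = A" using frechet_derivativeI[OF A] .
  have ia: "invf o\<^sub>L f' a = id_blinfun"
    by (rule blinfun_eqI) (simp add: f'[OF S(2)] fa invf B(2))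
  \<comment> \<open>The radius 1 / 2 is the contraction constant for the derivative of the
    inverse.\<close>
  define S' where "S' = (S \<inter> L -` ball 0 (1 / 2)) \<inter> T"
  have S': "open S'" "a \<in> S'" "S' \<subseteq> S"
    unfolding S'_def using continuous_open_preimage[OF Ck_on_continuous[OF Ls[of 0]] S(1), of "ball 0 (1/2)"] T S(2)
    by (auto simp: L_def ia)
  have derf: "(F has_derivative blinfun_apply (f' x)) (at x)" if "x \<in> S'" for x
    using smooth_on_has_derivative[OF S(3), of x] f'[of x] that S'(3) by auto
  obtain U V g g' where U: "open U" "U \<subseteq> S'" "a \<in> U" and V: "open V" and hom: "homeomorphism U V F g"
    and g: "\<And>y. y \<in> V \<Longrightarrow> (g has_derivative (g' y)) (at y)"
    and g': "\<And>y. y \<in> V \<Longrightarrow> g' y = inv (blinfun_apply (f' (g y)))"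
    and bij: "\<And>y. y \<in> V \<Longrightarrow> bij (blinfun_apply (f' (g y)))"
    by (rule inverse_function_theorem[OF S'(1) derf continuous_on_subset[OF Ck_on_continuous[OF f's[of 0]] S'(3)] S'(2) ia])
      (assumption, blast)
  have gV: "g ` V \<subseteq> S'" using hom U(2) unfolding homeomorphism_def by blast
  have z: "g' y v = L (g y) (g' y v) + invf v" if y: "y \<in> V" for y v
  proof -
    have "f' (g y) (g' y v) = v"
      unfolding g'[OF y] using bij[OF y] by (simp add: bij_is_surj surj_f_inv_f)
    then show ?thesis by (simp add: L_def blinfun.diff_left)
  qed
  have "Ck_on k V g" for k
  proof (induction k)
    case 0
    show ?case using hom by (simp add: homeomorphism_def)
  next
    case (Suc k)
    show ?case
    proof (rule Ck_on_SucI[OF V g])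
      fix v
      have "Ck_on k V (\<lambda>y. L (g y))"
        by (rule Ck_on_compose[OF V S'(1) gV Suc Ck_on_subset[OF Ls S'(3)]])
      moreover have "norm (L (g y)) \<le> 1 / 2" if "y \<in> V" for y
        using gV that by (force simp: S'_def)
      ultimately show "Ck_on k V (\<lambda>y. g' y v)"
        by (intro Ck_on_linear_fixpoint[OF V _ Ck_on_const[OF V, of k "invf v"] _ _ z, where \<kappa> = "1 / 2"]) auto
    qed
  qed
  moreover have "smooth_on U F" using smooth_on_subset[OF S(3)] U(2) S'(3) by blast
  ultimately have "diffeomorphism U V F"
    unfolding diffeomorphism_def using U V hom by (auto simp: smooth_on_def)
  moreover have "U \<subseteq> T" using U(2) by (auto simp: S'_def)
  ultimately show thesis using that U(3) by blast
qed

lemma partial_t_eq: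
  assumes "(f has_derivative D) (at q)"
  shows "partial_t f q = D (1, 0)"
proof -
  obtain t x where q: "q = (t, x)" by (cases q)
  have "((\<lambda>s. (s, x)) has_derivative (\<lambda>h. (h, 0))) (at t)"
    by (auto intro!: derivative_eq_intros)
  from has_derivative_compose[OF this, of f D] assms
  have "((\<lambda>s. f (s, x)) has_derivative (\<lambda>h. D (h, 0))) (at t)" by (simp add: q)
  moreover have "(\<lambda>h. D (h, 0)) = (*) (D (1, 0))"
  proof
    show "D (h, 0) = D (1, 0) * h" for h
      using linear_scale[OF has_derivative_linear[OF assms], of h "(1, 0)"] by (simp add: mult.commute)
  qed
  ultimately have "((\<lambda>s. f (s, x)) has_field_derivative D (1, 0)) (at t)"
    by (simp add: has_field_derivative_def)
  then show ?thesis by (simp add: partial_t_def q DERIV_imp_deriv)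
qed

lemma partial_x_eq:
  assumes "(f has_derivative D) (at q)"
  shows "partial_x f q = D (0, 1)"
proof -
  obtain t x where q: "q = (t, x)" by (cases q)
  have "((\<lambda>s. (t, s)) has_derivative (\<lambda>h. (0, h))) (at x)"
    by (auto intro!: derivative_eq_intros)
  from has_derivative_compose[OF this, of f D] assms
  have "((\<lambda>s. f (t, s)) has_derivative (\<lambda>h. D (0, h))) (at x)" by (simp add: q)
  moreover have "(\<lambda>h. D (0, h)) = (*) (D (0, 1))"
  proof
    show "D (0, h) = D (0, 1) * h" for h
      using linear_scale[OF has_derivative_linear[OF assms], of h "(0, 1)"] by (simp add: mult.commute)
  qed
  ultimately have "((\<lambda>s. f (t, s)) has_field_derivative D (0, 1)) (at x)"
    by (simp add: has_field_derivative_def)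
  then show ?thesis by (simp add: partial_x_def q DERIV_imp_deriv)
qed

theorem theorem10:
  fixes n :: nat and \<alpha> \<gamma> :: "real \<times> real \<Rightarrow> real" and x\<^sub>0 :: real and U :: "(real \<times> real) set"
  assumes "n \<ge> 1"
    and "open U" and "(0, x\<^sub>0) \<in> U"
    and "smooth_on U \<alpha>" and "\<And>q. q \<in> U \<Longrightarrow> \<alpha> q > 0"
    and "smooth_on U \<gamma>" and "\<And>q. q \<in> U \<Longrightarrow> \<gamma> q > 0"
  shows "\<exists>(\<phi> :: real \<Rightarrow> real) J.
    open J \<and> 0 \<in> J \<and> smooth_on J \<phi> \<and>
    smoothly_orbitally_equivalent (geodesic_field n \<alpha> \<gamma>) (0, x\<^sub>0, 0) (normal_form n \<phi>) (0, 0, 0)"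
proof -

  \<comment> \<open>The coordinate P and the transformed coefficients \<open>f\<close>,
    \<open>g\<close>\<close>
  let ?a = "(0, x\<^sub>0, 0) :: real \<times> real \<times> real"
  define \<pi> where "\<pi> q = (fst q, fst (snd q))" for q :: "real \<times> real \<times> real"
  have \<pi>s: "smooth_near q \<pi>" for q unfolding \<pi>_def by (intro smooth_near_intros)
  have \<pi>a: "\<pi> ?a = (0, x\<^sub>0)" by (simp add: \<pi>_def)
  have lift: "smooth_near ?a (\<lambda>q. h (\<pi> q))" if "smooth_near (0, x\<^sub>0) h" for h :: "real \<times> real \<Rightarrow> real"
    by (rule smooth_near_compose[OF \<pi>s]) (simp add: \<pi>a that)
  have \<alpha>: "smooth_near (0, x\<^sub>0) \<alpha>" and \<gamma>: "smooth_near (0, x\<^sub>0) \<gamma>"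
    by (rule smooth_nearI[OF assms(2,3,4)], rule smooth_nearI[OF assms(2,3,6)])
  \<comment> \<open>This is \<alpha> / \<gamma> on \<open>U\<close>; written as a power, its
    smoothness follows from positivity of \<gamma> at the point.\<close>
  define \<kappa> where "\<kappa> q = \<alpha> q * \<gamma> q powr (-1)" for q
  have \<kappa>: "smooth_near (0, x\<^sub>0) \<kappa>"
    unfolding \<kappa>_def using assms(3,7) by (intro smooth_near_mult \<alpha> smooth_near_powr \<gamma>) auto
  have \<kappa>_eq: "\<kappa> q = \<alpha> q / \<gamma> q" if "q \<in> U" for q
    using assms(7)[OF that] by (simp add: \<kappa>_def powr_minus divide_inverse)
  define W where "W q = 1 + \<kappa> (\<pi> q) * snd (snd q) ^ 2" for q
  have Ws: "smooth_near ?a W" unfolding W_def by (intro smooth_near_intros lift \<kappa>)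
  have Wa: "W ?a = 1" by (simp add: W_def)
  define P where "P q = snd (snd q) * W q powr (- 1 / 2)" for q
  have Ps: "smooth_near ?a P" unfolding P_def by (intro smooth_near_intros smooth_near_powr Ws) (simp add: Wa)
  define \<Psi> where "\<Psi> q = (fst q, fst (snd q), P q)" for q
  have \<Psi>s: "smooth_near ?a \<Psi>" unfolding \<Psi>_def by (intro smooth_near_intros Ps)
  have \<Psi>a: "\<Psi> ?a = ?a" by (simp add: \<Psi>_def P_def)
  \<comment> \<open>The terms of \<open>geodesic_M\<close> with an explicit factor t, divided by t.
    The others add up to - 2 n \<alpha> p (\<gamma> + \<alpha> p^2) = - 2 n \<alpha> \<gamma> p W,
    so the equation for p becomes p' = n p W + t m with \<open>m\<close> below.\<close>
  define M1 where "M1 q = \<alpha> (\<pi> q) * frechet_derivative \<alpha> (at (\<pi> q)) (1, 0) * snd (snd q) ^ 3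
     + (frechet_derivative \<alpha> (at (\<pi> q)) (0, 1) * \<gamma> (\<pi> q) - 2 * \<alpha> (\<pi> q) * frechet_derivative \<gamma> (at (\<pi> q)) (0, 1)) * snd (snd q) ^ 2
     + (2 * frechet_derivative \<alpha> (at (\<pi> q)) (1, 0) * \<gamma> (\<pi> q) - \<alpha> (\<pi> q) * frechet_derivative \<gamma> (at (\<pi> q)) (1, 0)) * snd (snd q)
     - \<gamma> (\<pi> q) * frechet_derivative \<gamma> (at (\<pi> q)) (0, 1)" for q
  have M1s: "smooth_near ?a M1"
    unfolding M1_def by (intro smooth_near_intros lift \<alpha> \<gamma> smooth_near_frechet)
  define m where "m q = - M1 q * (2 * \<alpha> (\<pi> q) * \<gamma> (\<pi> q)) powr (- 1)" for q
  have ms: "smooth_near ?a m"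
    unfolding m_def using assms(3,5,7)
    by (intro smooth_near_intros smooth_near_powr M1s lift \<alpha> \<gamma>) (simp add: \<pi>a)
  \<comment> \<open>The remainder in P' = n P + t h, still as a function of (t, x, p). The
    subtracted term comes from differentiating \<kappa> along the field, where t' = t and x' = t p
    each bring the factor t.\<close>
  define h where "h q = (m q - snd (snd q) ^ 3 * (frechet_derivative \<kappa> (at (\<pi> q)) (1, 0)
      + snd (snd q) * frechet_derivative \<kappa> (at (\<pi> q)) (0, 1)) * (1 / 2)) * W q powr (- 3 / 2)" for q
  have hs: "smooth_near ?a h"
    unfolding h_def
    by (intro smooth_near_intros smooth_near_powr ms lift \<kappa> smooth_near_frechet Ws) (simp add: Wa)
  \<comment> \<open>The inverse of the passage from p to P, as 1 - \<kappa> P^2 = 1 / W. Because x'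
    = t p, it is also the coefficient of t in the x-equation.\<close>
  define f where "f q = snd (snd q) * (1 - \<kappa> (\<pi> q) * snd (snd q) ^ 2) powr (- 1 / 2)" for q
  have fs: "smooth_near ?a f"
    unfolding f_def by (intro smooth_near_intros smooth_near_powr lift \<kappa>) simp
  define g where "g q = h (fst q, fst (snd q), f q)" for q
  have "smooth_near ?a (\<lambda>q. (fst q, fst (snd q), f q))"
    by (intro smooth_near_intros fs)
  from smooth_near_compose[OF this] have gs: "smooth_near ?a g"
    unfolding g_def using hs by (simp add: f_def)
  interpret resonant_field n x\<^sub>0 f g
    by standard (use assms(1) fs gs in auto)

  \<comment> \<open>Conjugation of the geodesic field to \<open>V\<close>\<close>
  have nearU: "\<forall>\<^sub>F q in nhds ?a. \<pi> q \<in> U"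
    using smooth_near_isCont[OF \<pi>s[of ?a]] assms(2,3) topological_tendstoD[of \<pi> "(0, x\<^sub>0)" "nhds ?a" U]
    by (simp add: isCont_def tendsto_nhds_iff \<pi>a)
  have conj: "\<forall>\<^sub>F q in nhds ?a. \<exists>D. (\<Psi> has_derivative D) (at q) \<and> D (geodesic_field n \<alpha> \<gamma> q) = V (\<Psi> q)"
    using nearU
  proof eventually_elim
    case (elim q)
    obtain t x p where q: "q = (t, x, p)" by (cases q) auto
    have \<pi>q: "\<pi> q = (t, x)" by (simp add: \<pi>_def q)
    have pos: "\<alpha> (t, x) > 0" "\<gamma> (t, x) > 0" using assms(5,7) elim \<pi>q by auto
    have \<kappa>pos: "\<kappa> (t, x) > 0" using \<kappa>_eq elim pos \<pi>q by simp
    have Wq: "W q = 1 + \<kappa> (t, x) * p ^ 2" by (simp add: W_def \<pi>q) (simp add: q)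
    have Wpos: "W q > 0" unfolding Wq using \<kappa>pos by (simp add: add_pos_nonneg)
    let ?D = "frechet_derivative \<kappa> (at (t, x))"
    have U': "(\<alpha> has_derivative frechet_derivative \<alpha> (at (t, x))) (at (t, x))"
      "(\<gamma> has_derivative frechet_derivative \<gamma> (at (t, x))) (at (t, x))"
      using smooth_on_has_derivative assms(4,6) elim \<pi>q by auto
    have \<kappa>d: "(\<kappa> has_derivative ?D) (at (t, x))"
    proof -
      have "smooth_near (t, x) \<kappa>"
        unfolding \<kappa>_def using pos elim \<pi>q
        by (intro smooth_near_mult smooth_near_powr smooth_nearI[OF assms(2) _ assms(4)] smooth_nearI[OF assms(2) _ assms(6)]) auto
      then show ?thesis by (rule smooth_near_has_derivative_at)
    qed
    have Wd: "(W has_derivative (\<lambda>v. ?D (fst v, fst (snd v)) * p ^ 2 + \<kappa> (t, x) * (2 * p * snd (snd v)))) (at q)"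
    proof -
      have "((\<lambda>q. \<kappa> (\<pi> q)) has_derivative (\<lambda>v. ?D (fst v, fst (snd v)))) (at q)"
      proof (rule has_derivative_compose[of \<pi>])
        show "(\<pi> has_derivative (\<lambda>v. (fst v, fst (snd v)))) (at q)"
          unfolding \<pi>_def by (auto intro!: derivative_eq_intros)
        show "(\<kappa> has_derivative ?D) (at (\<pi> q))" using \<kappa>d \<pi>q by simp
      qed
      then show ?thesis
        unfolding W_def by (auto intro!: derivative_eq_intros simp: \<pi>q \<pi>q[unfolded q] q algebra_simps)
    qed
    have pd: "((\<lambda>q. snd (snd q)) has_derivative (\<lambda>v. snd (snd v))) (at q)"
      by (auto intro!: derivative_eq_intros)
    have Wpd: "((\<lambda>q. W q powr (- 1 / 2)) has_derivative
      (\<lambda>v. - 1 / 2 * W q powr (- 3 / 2) * (?D (fst v, fst (snd v)) * p ^ 2 + \<kappa> (t, x) * (2 * p * snd (snd v))))) (at q)"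
    proof -
      have "((\<lambda>y. y powr (- 1 / 2)) has_real_derivative - 1 / 2 * W q powr (- 3 / 2)) (at (W q))"
        using Wpos by (auto intro!: derivative_eq_intros)
      then have "((\<lambda>y. y powr (- 1 / 2)) has_derivative (\<lambda>v. - 1 / 2 * W q powr (- 3 / 2) * v)) (at (W q))"
        by (rule has_field_derivative_imp_has_derivative)
      from has_derivative_compose[OF Wd this] show ?thesis by simp
    qed
    define DP where "DP v = p * (- 1 / 2 * W q powr (- 3 / 2) * (?D (fst v, fst (snd v)) * p ^ 2 + \<kappa> (t, x) * (2 * p * snd (snd v))))
        + snd (snd v) * W q powr (- 1 / 2)" for v
    have Pd: "(P has_derivative DP) (at q)"
      using has_derivative_mult[OF pd Wpd] unfolding P_def DP_def by (simp add: q)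
    have \<Psi>d: "(\<Psi> has_derivative (\<lambda>v. (fst v, fst (snd v), DP v))) (at q)"
      unfolding \<Psi>_def
      by (intro has_derivative_Pair has_derivative_fst has_derivative_snd has_derivative_ident Pd)
    have W12: "W q powr (- 1 / 2) = W q * W q powr (- 3 / 2)"
      using Wpos powr_mult_base[of "W q" "- 3 / 2"] by simp
    have field: "geodesic_field n \<alpha> \<gamma> q = (t, t * p, real n * p * W q + t * m q)"
    proof -
      have mq: "m q = - M1 q / (2 * \<alpha> (t, x) * \<gamma> (t, x))"
        using pos by (simp add: m_def \<pi>q powr_minus_divide)
      have "geodesic_M n \<alpha> \<gamma> q = t * M1 q - 2 * real n * \<alpha> (t, x) * p * (\<gamma> (t, x) + \<alpha> (t, x) * p ^ 2)"
        unfolding M1_def \<pi>q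
        by (simp add: q geodesic_M_def mu0_def mu1_def mu2_def mu3_def partial_t_eq[OF U'(1)] partial_t_eq[OF U'(2)]
            partial_x_eq[OF U'(1)] partial_x_eq[OF U'(2)] algebra_simps power2_eq_square power3_eq_cube)
      moreover have "\<gamma> (t, x) + \<alpha> (t, x) * p ^ 2 = \<gamma> (t, x) * W q"
        using pos \<kappa>_eq[of "(t, x)"] elim \<pi>q by (simp add: Wq field_simps)
      ultimately have "geodesic_M n \<alpha> \<gamma> q = t * M1 q - 2 * real n * \<alpha> (t, x) * p * (\<gamma> (t, x) * W q)"
        by simp
      then have "- (geodesic_M n \<alpha> \<gamma> q / (2 * \<alpha> (t, x) * \<gamma> (t, x))) = real n * p * W q + t * m q"
        using pos by (simp add: mq field_simps)
      then show ?thesis by (simp add: geodesic_field_def q mult.commute)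
    qed
    have D1: "?D (t, t * p) = t * (?D (1, 0) + p * ?D (0, 1))"
    proof -
      have l: "linear ?D" using has_derivative_linear[OF \<kappa>d] .
      have "(t, t * p) = t *\<^sub>R (1, 0) + (t * p) *\<^sub>R (0 :: real, 1 :: real)" by simp
      then have "?D (t, t * p) = t *\<^sub>R ?D (1, 0) + (t * p) *\<^sub>R ?D (0, 1)"
        by (simp only: linear_add[OF l] linear_scale[OF l])
      then show ?thesis by (simp add: algebra_simps)
    qed
    have fq: "f (\<Psi> q) = p"
    proof -
      have Winv: "W q powr (- 1) = 1 / W q"
        using Wpos by (simp add: powr_minus_divide)
      have "(W q powr (- 1 / 2)) ^ 2 = W q powr (- 1 / 2 + - 1 / 2)"
        unfolding power2_eq_square powr_add ..
      then have P2: "P q ^ 2 = p ^ 2 / W q"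
        using Winv by (simp add: P_def power_mult_distrib) (simp add: q)
      have "1 - \<kappa> (t, x) * P q ^ 2 = W q powr (- 1)"
        unfolding P2 Winv using Wpos Wq by (simp add: field_simps)
      then have "(1 - \<kappa> (t, x) * P q ^ 2) powr (- 1 / 2) = W q powr (1 / 2)"
        by (simp only: powr_powr) simp
      then have "f (\<Psi> q) = p * (W q powr (- 1 / 2) * W q powr (1 / 2))"
        by (simp add: f_def \<Psi>_def \<pi>_def q) (simp add: P_def)
      then show ?thesis using Wpos by (simp add: powr_add[symmetric])
    qed
    have gq: "g (\<Psi> q) = h q"
      unfolding g_def fq by (simp add: \<Psi>_def q)
    have "DP (geodesic_field n \<alpha> \<gamma> q) = real n * P q + t * h q"
    \<comment> \<open>The cancellation behind the linearisation: the p-derivative of p W^(-1/2) is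
      W^(-3/2) (W - \<kappa> p^2) = W^(-3/2), which takes n p W to n p W^(-1/2) = n P.\<close>
    proof -
      define w where "w = W q powr (- 3 / 2)"
      have w: "W q powr (- 1 / 2) = W q * w" using W12 by (simp add: w_def)
      have "DP (geodesic_field n \<alpha> \<gamma> q) = w * (p * (- 1 / 2 * (t * (?D (1, 0) + p * ?D (0, 1)) * p ^ 2
          + \<kappa> (t, x) * (2 * p * (real n * p * W q + t * m q)))) + (real n * p * W q + t * m q) * W q)"
        unfolding DP_def field fst_conv snd_conv D1 w w_def[symmetric] by (simp add: algebra_simps)
      also have "\<dots> = real n * p * (W q * w) + t * ((m q - p ^ 3 * (?D (1, 0) + p * ?D (0, 1)) * (1 / 2)) * w)"
      proof -
        have "w * (p * (- 1 / 2 * (t * a * p ^ 2 + k * (2 * p * (N * p * (1 + k * p ^ 2) + t * mm)))) +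
            (N * p * (1 + k * p ^ 2) + t * mm) * (1 + k * p ^ 2))
          = N * p * ((1 + k * p ^ 2) * w) + t * ((mm - p ^ 3 * a * (1 / 2)) * w)" for a k N mm :: real
          by (simp add: field_simps power2_eq_square power3_eq_cube)
        then show ?thesis unfolding Wq .
      qed
      also have "\<dots> = real n * P q + t * h q"
        unfolding P_def h_def \<pi>q w w_def[symmetric] by (simp add: q)
      finally show ?thesis .
    qed
    then have "(\<lambda>v. (fst v, fst (snd v), DP v)) (geodesic_field n \<alpha> \<gamma> q) = V (\<Psi> q)"
      unfolding V_def fq gq field by (simp add: \<Psi>_def q)
    with \<Psi>d show ?case by blast
  qed

  \<comment> \<open>The chart in which the field has normal form\<close>
  obtain s z \<rho> where s: "smooth_near ?a s" and z: "smooth_near ?a z" and \<rho>: "smooth_near x\<^sub>0 \<rho>"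
    and \<zeta>: "lie (\<lambda>q. fst (snd q) - fst q * z q) (\<lambda>_. 0)"
    and \<xi>: "lie (\<lambda>q. snd (snd q) + fst q * s q)
      (\<lambda>q. real n * (snd (snd q) + fst q * s q) + \<rho> (fst (snd q) - fst q * z q) * fst q ^ n)"
    by (rule normal_coordinates)
  \<comment> \<open>The translation by \<open>x\<^sub>0\<close> moves the image of the singular
    point to the origin; the argument of \<open>\<phi>\<close> compensates for it.\<close>
  define H where "H q = (snd (snd q) + fst q * s q, fst q, fst (snd q) - fst q * z q - x\<^sub>0)" for q
  define F where "F q = H (\<Psi> q)" for q
  define \<phi> where "\<phi> y = \<rho> (x\<^sub>0 + y)" for y
  have "smooth_near ?a H" unfolding H_def by (intro smooth_near_intros s z)
  then have Fs: "smooth_near ?a F"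
    unfolding F_def using \<Psi>a by (intro smooth_near_compose[OF \<Psi>s]) simp
  have "smooth_near 0 \<phi>"
    unfolding \<phi>_def by (rule smooth_near_compose[where f = "\<lambda>y. x\<^sub>0 + y"]) (auto intro!: smooth_near_intros \<rho>)
  then obtain J where J: "open J" "0 \<in> J" "smooth_on J \<phi>" unfolding smooth_near_def by blast
  have Heq: "\<forall>\<^sub>F q in nhds ?a. \<exists>D. (H has_derivative D) (at q) \<and> D (V q) = normal_form n \<phi> (H q)"
    using lie_has_derivative[OF \<zeta>] lie_has_derivative[OF \<xi>]
  proof eventually_elim
    case (elim q)
    let ?z = "frechet_derivative (\<lambda>q. fst (snd q) - fst q * z q) (at q)"
    let ?x = "frechet_derivative (\<lambda>q. snd (snd q) + fst q * s q) (at q)"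
    have "((\<lambda>q. fst (snd q) - fst q * z q - x\<^sub>0) has_derivative (\<lambda>v. ?z v - 0)) (at q)"
      using elim(1) by (intro has_derivative_diff has_derivative_const) blast
    then have "(H has_derivative (\<lambda>v. (?x v, fst v, ?z v - 0))) (at q)"
      unfolding H_def using elim(2)
      by (intro has_derivative_Pair has_derivative_fst has_derivative_ident) blast+
    moreover have "(\<lambda>v. (?x v, fst v, ?z v - 0)) (V q) = normal_form n \<phi> (H q)"
      using elim by (simp add: normal_form_def H_def \<phi>_def V_def)
    ultimately show ?case by blast
  qed
  have "filterlim \<Psi> (nhds ?a) (nhds ?a)"
    using smooth_near_isCont[OF \<Psi>s] by (simp add: isCont_def tendsto_nhds_iff \<Psi>a)
  then have "\<forall>\<^sub>F q in nhds ?a. \<exists>D. (H has_derivative D) (at (\<Psi> q)) \<and> D (V (\<Psi> q)) = normal_form n \<phi> (H (\<Psi> q))"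
    using Heq unfolding filterlim_iff by blast
  with conj have "\<forall>\<^sub>F q in nhds ?a. frechet_derivative F (at q) (geodesic_field n \<alpha> \<gamma> q) = normal_form n \<phi> (F q)"
  proof eventually_elim
    case (elim q)
    then obtain D E where D: "(\<Psi> has_derivative D) (at q)" "D (geodesic_field n \<alpha> \<gamma> q) = V (\<Psi> q)"
      and E: "(H has_derivative E) (at (\<Psi> q))" "E (V (\<Psi> q)) = normal_form n \<phi> (H (\<Psi> q))" by blast
    have "(F has_derivative (\<lambda>v. E (D v))) (at q)"
      unfolding F_def using has_derivative_compose[OF D(1) E(1)] .
    then show ?case using frechet_derivativeI[of F _ q] D(2) E(2) by (simp add: F_def)
  qed
  then obtain T where T: "open T" "?a \<in> T"
    and eqT: "\<And>q. q \<in> T \<Longrightarrow> frechet_derivative F (at q) (geodesic_field n \<alpha> \<gamma> q) = normal_form n \<phi> (F q)"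
    unfolding eventually_nhds by blast

  \<comment> \<open>Invertibility of the chart\<close>
  define sa za where "sa = s ?a" and "za = z ?a"
  \<comment> \<open>At the singular point W = 1 and p = t = 0, so the derivatives of
    \<open>W\<close>, \<open>s\<close> and \<open>z\<close> drop out; what remains is triangular up
    to the order of the coordinates, with unit entries.\<close>
  have Fd: "(F has_derivative (\<lambda>v. (snd (snd v) + fst v * sa, fst v, fst (snd v) - fst v * za))) (at ?a)"
  proof -
    have Wda: "(W has_derivative frechet_derivative W (at ?a)) (at ?a)"
      by (rule smooth_near_has_derivative_at[OF Ws])
    have Wp: "smooth_near ?a (\<lambda>q. W q powr (- 1 / 2))"
      by (intro smooth_near_powr Ws) (simp add: Wa)
    have Pd: "(P has_derivative (\<lambda>v. snd (snd v))) (at ?a)"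
    proof -
      have "((\<lambda>q. snd (snd q)) has_derivative (\<lambda>v. snd (snd v))) (at ?a)"
        by (auto intro!: derivative_eq_intros)
      from has_derivative_mult[OF this smooth_near_has_derivative_at[OF Wp]] show ?thesis
        unfolding P_def by (simp add: Wa)
    qed
    have td: "((\<lambda>q. fst q * k (\<Psi> q)) has_derivative (\<lambda>v. fst v * k ?a)) (at ?a)"
      if "smooth_near ?a k" for k :: "real \<times> real \<times> real \<Rightarrow> real"
    proof -
      have "smooth_near ?a (\<lambda>q. k (\<Psi> q))" by (rule smooth_near_compose[OF \<Psi>s]) (simp add: \<Psi>a that)
      from has_derivative_mult[OF bounded_linear_imp_has_derivative[OF bounded_linear_fst] smooth_near_has_derivative_at[OF this]]
      show ?thesis by (simp add: \<Psi>a)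
    qed
    have xd: "((\<lambda>q. fst (snd q)) has_derivative (\<lambda>v. fst (snd v))) (at ?a)"
      by (auto intro!: derivative_eq_intros)
    have "((\<lambda>q. (P q + fst q * s (\<Psi> q), fst q, fst (snd q) - fst q * z (\<Psi> q) - x\<^sub>0)) has_derivative
        (\<lambda>v. (snd (snd v) + fst v * s ?a, fst v, fst (snd v) - fst v * z ?a - 0))) (at ?a)"
      by (intro has_derivative_Pair has_derivative_add has_derivative_diff has_derivative_const Pd td s z xd
          bounded_linear_imp_has_derivative[OF bounded_linear_fst])
    then show ?thesis by (simp add: F_def[abs_def] H_def \<Psi>_def[abs_def] sa_def za_def)
  qed
  \<comment> \<open>The inverse of the derivative just computed, solved for (t, x, p).\<close>
  have "bounded_linear (\<lambda>v. (fst (snd v), snd (snd v) + fst (snd v) * za, fst v - fst (snd v) * sa))"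
    by (intro bounded_linear_Pair bounded_linear_add bounded_linear_sub bounded_linear_mult_const
        bounded_linear_compose[OF bounded_linear_fst] bounded_linear_compose[OF bounded_linear_snd] bounded_linear_fst bounded_linear_snd)
  then obtain U' W' where UW: "diffeomorphism U' W' F" "?a \<in> U'" "U' \<subseteq> T"
    by (rule smooth_local_diffeomorphism[OF Fs Fd _ _ T]) auto
  have "F ?a = (0, 0, 0)" by (simp add: F_def H_def \<Psi>a)
  moreover have "open U'" using UW(1) by (simp add: diffeomorphism_def)
  \<comment> \<open>The multiplier is the constant 1: t' = t is already the equation of \<eta>, and
    the chart conjugates the fields themselves.\<close>
  then have "smooth_on U' (\<lambda>_. 1 :: real)" by (simp add: smooth_on_def)
  ultimately have "smoothly_orbitally_equivalent (geodesic_field n \<alpha> \<gamma>) ?a (normal_form n \<phi>) (0, 0, 0)"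
    unfolding smoothly_orbitally_equivalent_def using UW eqT
    by (intro exI[of _ U'] exI[of _ W'] exI[of _ F] exI[of _ "\<lambda>_. 1 :: real"]) auto
  with J show ?thesis by blast
qed

end
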